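(* Let $U$ be the telescoping potential of $\nu_\beta^+$. The pressure (or free energy density) $$P(U):=\lim_{V\uparrow\mathbb{Z}}\frac1{|V|}\log Z^f_V$$ exists, where $$Z^f_V=\sum_{\sigma\in\Omega_V}\exp\Big[-\sum_{A\subset V}U(A,\sigma)\Big]$$ is the finite volume ($V$) partition function with free boundary conditions.
   Context: Ising model on $\mathbb{Z}^2$ at zero field and inverse temperature $\beta$: for finite $\Lambda\subset\mathbb{Z}^2$, $\mu^+_{\Lambda,\beta}$ is the probability measure on $\{\pm1\}^\Lambda$ with weights proportional to $\exp[\beta\sum_{\langle xy\rangle:\{x,y\}\cap\Lambda\ne\emptyset}(\sigma_x\sigma_y-1)]$ (nearest neighbour pairs, $\sigma_y=+1$ for $y\notin\Lambda$); $\mu_\beta^+=\lim_\Lambda\mu^+_{\Lambda,\beta}$ is the plus phase with random field $X$. $\Omega=\{\pm1\}^{\mathbb{Z}}$, $\Omega_V=\{\pm1\}^V$; $\nu_\beta^+$ is the law on $\Omega$ of $(X((i,0)))_{i\in\mathbb{Z}}$. $\sigma^V$ equals $\sigma$ on $V$ and $+1$ off $V$; $+$ is the all-plus configuration. $V\uparrow\mathbb{Z}$ denotes the thermodynamic limit over finite volumes $V\subset\mathbb{Z}$. Specification $\Gamma$ (the monotone right-continuous specification with which $\nu_\beta^+$ is consistent): with $\Lambda_n=([-n,n]\cap\mathbb{Z})^2$, for finite $V\subset\mathbb{Z}$, $\sigma\in\Omega_V$, $\omega\in\Omega$, $$\gamma_V(\sigma|\omega)=\lim_{n\to\infty}\mu^+_{\Lambda_n,\beta}\big(X(i,0)=\sigma_i,\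 i\in V\,\big|\,X(i,0)=\omega_i,\ i\in[-n,n]\setminus V\big).$$ Telescoping potential $U$: for $i\in\mathbb{Z}$, $U(\{i\},\xi)=\ln\frac{\gamma_{\{i\}}(+|+)}{\gamma_{\{i\}}(\xi^{\{i\}}|+)}$; for $j<i$, with $\gamma=\gamma_{[j,i]}$, $$U([j,i],\xi)=\ln\frac{\gamma(\xi^{]j,i]}|+)\,\gamma(\xi^{[j,i[}|+)}{\gamma(\xi^{]j,i[}|+)\,\gamma(\xi^{[j,i]}|+)},$$ where $[j,i]=\{j,\dots,i\}$, $]j,i]=\{j+1,\dots,i\}$, $[j,i[=\{j,\dots,i-1\}$, $]j,i[=\{j+1,\dots,i-1\}$; $U(A,\cdot)=0$ for all other finite $A$. $U(A,\sigma)$ depends only on $\sigma_A$, so it is defined for $\sigma\in\Omega_V$ when $A\subset V$. *)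

theory Defs
  imports "HOL-Probability.Probability"
begin

section \<open>Spin configurations\<close>

text \<open>\<open>{\<plusminus>1}\<^sup>V\<close>; the spins are real numbers, and a configuration on \<open>V\<close> is \<^const>\<open>undefined\<close> off \<open>V\<close>.\<close>

definition spin_configs :: "'a set \<Rightarrow> ('a \<Rightarrow> real) set" where
  "spin_configs V = (V \<rightarrow>\<^sub>E {-1, 1})"

text \<open>The configuration \<open>\<sigma>\<^sup>V\<close>, equal to \<open>\<sigma>\<close> on \<open>V\<close> and to \<open>+1\<close> off \<open>V\<close>.\<close>

definition plus_ext :: "'a set \<Rightarrow> ('a \<Rightarrow> real) \<Rightarrow> 'a \<Rightarrow> real" where
  "plus_ext V \<sigma> = (\<lambda>i. if i \<in> V then \<sigma> i else 1)"

definition all_plus :: "'a \<Rightarrow> real" where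
  "all_plus = (\<lambda>_. 1)"


section \<open>The finite-volume Ising model with plus boundary condition\<close>

definition nn_edges :: "(int \<times> int) set set" where
  "nn_edges = {{x, y} | x y. \<bar>fst x - fst y\<bar> + \<bar>snd x - snd y\<bar> = 1}"

text \<open>For an edge \<open>e = {x, y}\<close>, the product over \<open>e\<close> is \<open>\<sigma>\<^sub>x \<sigma>\<^sub>y\<close>.\<close>

definition ising_weight :: "real \<Rightarrow> (int \<times> int) set \<Rightarrow> (int \<times> int \<Rightarrow> real) \<Rightarrow> real" where
  "ising_weight \<beta> \<Lambda> \<sigma> =
     exp (\<beta> * (\<Sum>e\<in>{e \<in> nn_edges. e \<inter> \<Lambda> \<noteq> {}}. (\<Prod>x\<in>e. plus_ext \<Lambda> \<sigma> x) - 1))"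

definition ising_plus :: "real \<Rightarrow> (int \<times> int) set \<Rightarrow> (int \<times> int \<Rightarrow> real) measure" where
  "ising_plus \<beta> \<Lambda> = point_measure (spin_configs \<Lambda>)
     (\<lambda>\<sigma>. ennreal (ising_weight \<beta> \<Lambda> \<sigma> / (\<Sum>\<tau>\<in>spin_configs \<Lambda>. ising_weight \<beta> \<Lambda> \<tau>)))"

definition centered_square :: "nat \<Rightarrow> (int \<times> int) set" where
  "centered_square n = {- int n..int n} \<times> {- int n..int n}"


section \<open>The specification of the restriction of the plus phase to a line\<close>

text \<open>
  Only the values of \<open>\<sigma>\<close> on \<open>V\<close> and of \<open>\<omega>\<close> off \<open>V\<close> matter. The terms of the sequence are
  meaningful once \<open>V\<close> is contained in \<open>{-n..n}\<close>; the finitely many others do not affect the limit.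
\<close>

definition line_spec :: "real \<Rightarrow> int set \<Rightarrow> (int \<Rightarrow> real) \<Rightarrow> (int \<Rightarrow> real) \<Rightarrow> real" where
  "line_spec \<beta> V \<sigma> \<omega> = lim (\<lambda>n.
     \<P>(X in ising_plus \<beta> (centered_square n). (\<forall>i\<in>V. X (i, 0) = \<sigma> i)
        \<bar> (\<forall>i\<in>{- int n..int n} - V. X (i, 0) = \<omega> i)))"


section \<open>The telescoping potential\<close>

text \<open>
  The first two cases are the singletons and the intervals \<open>[j, i]\<close> with \<open>j < i\<close>.
  Every configuration that enters is of the form \<open>\<xi>\<^sup>B\<close> with \<open>B \<subseteq> A\<close>, so the value depends only on
  the restriction of \<open>\<xi>\<close> to \<open>A\<close>.
\<close>

definition telescoping_potential :: "real \<Rightarrow> int set \<Rightarrow> (int \<Rightarrow> real) \<Rightarrow> real" where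
  "telescoping_potential \<beta> A \<xi> =
    (if \<exists>i. A = {i} then
       ln (line_spec \<beta> A all_plus all_plus / line_spec \<beta> A (plus_ext A \<xi>) all_plus)
     else if \<exists>j i. j < i \<and> A = {j..i} then
       (let j = Min A; i = Max A; \<gamma> = (\<lambda>\<sigma>. line_spec \<beta> {j..i} \<sigma> all_plus) in
         ln ((\<gamma> (plus_ext {j<..i} \<xi>) * \<gamma> (plus_ext {j..<i} \<xi>)) /
             (\<gamma> (plus_ext {j<..<i} \<xi>) * \<gamma> (plus_ext {j..i} \<xi>))))
     else 0)"


section \<open>Free partition function and thermodynamic limit\<close>

definition free_partition :: "(int set \<Rightarrow> (int \<Rightarrow> real) \<Rightarrow> real) \<Rightarrow> int set \<Rightarrow> real" where
  "free_partition U V = (\<Sum>\<sigma>\<in>spin_configs V. exp (- (\<Sum>A\<in>Pow V. U A \<sigma>)))"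

definition inner_boundary :: "int set \<Rightarrow> int set" where
  "inner_boundary V = {i \<in> V. \<exists>j. j \<notin> V \<and> \<bar>i - j\<bar> = 1}"

text \<open>
  \<open>V \<up> \<int>\<close> in the sense of van Hove: \<open>V\<close> is finite, eventually contains every given finite set, and
  \<open>|\<partial>V| / |V| \<rightarrow> 0\<close>. The boundary condition cannot be dropped: along the net of all finite sets
  ordered by inclusion, free-boundary pressures need not converge, because a positive fraction of
  the sites of \<open>V\<close> may be isolated in \<open>V\<close>.
\<close>

definition van_hove :: "int set filter" where
  "van_hove = inf (finite_subsets_at_top UNIV)
     (filtercomap (\<lambda>V. real (card (inner_boundary V)) / real (card V)) (nhds 0))"

lemma filterlim_intervals_van_hove:
  "filterlim (\<lambda>n. {- int n..int n}) van_hove sequentially"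
proof -
  have 1: "filterlim (\<lambda>n. {- int n..int n}) (finite_subsets_at_top UNIV) sequentially"
    unfolding filterlim_iff eventually_finite_subsets_at_top
  proof safe
    fix P and X :: "int set"
    assume X: "finite X" and P: "\<forall>Y. finite Y \<and> X \<subseteq> Y \<and> Y \<subseteq> UNIV \<longrightarrow> P Y"
    define m where "m = Max (insert 0 (abs ` X))"
    have m: "\<bar>x\<bar> \<le> m" if "x \<in> X" for x
      unfolding m_def using X that by (intro Max_ge) auto
    have "X \<subseteq> {- int n..int n}" if "n \<ge> nat m" for n
    proof
      fix x assume "x \<in> X"
      then have "\<bar>x\<bar> \<le> int n" using m[of x] that by linarith
      then show "x \<in> {- int n..int n}" by (simp add: abs_le_iff)
    qed
    then show "eventually (\<lambda>n. P {- int n..int n}) sequentially"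
      using P by (intro eventually_sequentiallyI[of "nat m"]) simp
  qed
  have b: "inner_boundary {- int n..int n} = {- int n, int n}" for n
  proof (intro equalityI subsetI)
    fix i assume "i \<in> {- int n, int n}"
    moreover have "int n \<in> inner_boundary {- int n..int n}"
      unfolding inner_boundary_def by (auto intro!: exI[of _ "int n + 1"])
    moreover have "- int n \<in> inner_boundary {- int n..int n}"
      unfolding inner_boundary_def by (auto intro!: exI[of _ "- int n - 1"])
    ultimately show "i \<in> inner_boundary {- int n..int n}" by blast
  qed (auto simp: inner_boundary_def)
  have "(\<lambda>n. real (card (inner_boundary {- int n..int n})) / real (card {- int n..int n}))
      \<longlonglongrightarrow> 0"
  proof (rule tendsto_sandwich[OF _ _ tendsto_const LIMSEQ_Suc[OF lim_const_over_n[of 2]]])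
    show "\<forall>\<^sub>F n in sequentially. real (card (inner_boundary {- int n..int n})) /
        real (card {- int n..int n}) \<le> 2 / real (Suc n)"
      by (intro always_eventually allI frac_le) (auto simp: b card_insert_if)
  qed auto
  then have 2: "filterlim (\<lambda>n. {- int n..int n}) (filtercomap
      (\<lambda>V. real (card (inner_boundary V)) / real (card V)) (nhds 0)) sequentially"
    by (simp add: filterlim_filtercomap_iff o_def)
  show ?thesis
    unfolding van_hove_def filterlim_inf using 1 2 by simp
qed

lemma van_hove_neq_bot: "van_hove \<noteq> bot"
proof
  assume "van_hove = bot"
  then have "filtermap (\<lambda>n. {- int n..int n}) sequentially = bot"
    using filterlim_intervals_van_hove unfolding filterlim_def by (simp add: bot_unique)
  then show False by (simp add: filtermap_bot_iff)
qed

definition pressure :: "(int set \<Rightarrow> (int \<Rightarrow> real) \<Rightarrow> real) \<Rightarrow> real" where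
  "pressure U = Lim van_hove (\<lambda>V. ln (free_partition U V) / real (card V))"

end

theory Submission
  imports Defs
begin

text \<open>
  Everything is expressed by sets of minus spins. In the Ising model with plus boundary condition the weight of a
  configuration is \<open>exp (- 2 \<beta> c)\<close>, where \<open>c\<close> is the number of edges that join its minus spins to plus spins.
  This number is a submodular function of the set of minus spins, so the weight is log-supermodular for
  \<open>\<beta> \<ge> 0\<close>, and a one-point-at-a-time version of the four-functions theorem (\<open>log_supermodular_sum_Pow\<close>)
  shows that the partition function is a log-supermodular function of the volume. This form of the FKG inequality
  is the only correlation inequality that enters.
  
  Condition the spins on the line outside a finite set \<open>V\<close> to be plus. The partition function of what remains,
  divided by that with the whole line plus, increases with the size of the square
  (\<open>plus_partition_ratio_mono\<close>), and it is bounded because flipping a spin costs a bounded energy. Its limit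
  \<open>R(V)\<close>, called \<open>line_partition\<close>, is the sum over \<open>M \<subseteq> V\<close> of weights \<open>\<rho>(M)\<close>, called \<open>line_weight\<close>, and
  the specification with plus boundary condition gives probability \<open>\<rho>(M) / R(V)\<close> to the configuration on \<open>V\<close>
  with minus spins \<open>M\<close>. The same monotonicity makes \<open>R\<close> translation invariant and supermultiplicative on
  disjoint sets.
  
  In the telescoping potential the factors \<open>R\<close> cancel, and the energy of a configuration on an interval telescopes
  to \<open>- ln \<rho>(M)\<close>. Thus the free partition function of an interval is \<open>R\<close> of the interval, and that of a general
  finite set is the product over its connected components. Now \<open>ln R\<close> is superadditive, nonnegative and at most
  linear in the length, so Fekete's lemma gives \<open>L\<close> with \<open>(L - \<epsilon>) n - K \<le> ln R \<le> L n\<close> for intervals of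
  length \<open>n\<close>, with \<open>K\<close> depending on \<open>\<epsilon>\<close> only. Adding these bounds over the components of \<open>V\<close> costs \<open>K\<close> per
  component. There are at most as many components as sites in the inner boundary, a vanishing fraction of \<open>V\<close> in the
  sense of van Hove, so the free energy per site converges to \<open>L\<close>.
\<close>

section \<open>Log-supermodular set functions\<close>

definition log_supermodular :: "('a set \<Rightarrow> real) \<Rightarrow> bool" where
  "log_supermodular f \<longleftrightarrow> (\<forall>C. finite C \<longrightarrow> 0 < f C) \<and>
     (\<forall>C E. finite C \<longrightarrow> finite E \<longrightarrow> f C * f E \<le> f (C \<union> E) * f (C \<inter> E))"

lemma log_supermodularI:
  assumes "\<And>C. finite C \<Longrightarrow> 0 < f C"
    and "\<And>C E. finite C \<Longrightarrow> finite E \<Longrightarrow> f C * f E \<le> f (C \<union> E) * f (C \<inter> E)"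
  shows "log_supermodular f"
  using assms by (simp add: log_supermodular_def)

lemma log_supermodular_pos: "log_supermodular f \<Longrightarrow> finite C \<Longrightarrow> 0 < f C"
  by (simp add: log_supermodular_def)

lemma log_supermodularD:
  "log_supermodular f \<Longrightarrow> finite C \<Longrightarrow> finite E \<Longrightarrow> f C * f E \<le> f (C \<union> E) * f (C \<inter> E)"
  by (simp add: log_supermodular_def)

text \<open>
  The four-functions inequality on the two-element lattice. Write \<open>a\<close> and \<open>b\<close> for the two mixed products
  on the left, \<open>p\<close> and \<open>q\<close> for those on the right. Both \<open>a\<close> and \<open>b\<close> are at most \<open>p\<close>, and multiplying the
  two diagonal hypotheses gives \<open>a b \<le> p q\<close>; hence \<open>0 \<le> (p - a) (p - b)\<close> forces \<open>a + b \<le> p + q\<close>.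
\<close>

lemma two_point_inequality:
  fixes c0 c1 e0 e1 u0 u1 i0 i1 :: real
  assumes nonneg: "0 \<le> c0" "0 \<le> c1" "0 \<le> e0" "0 \<le> e1" "0 \<le> u0" "0 < u1" "0 < i0" "0 \<le> i1"
    and "c1 * e1 \<le> u1 * i1" "c0 * e0 \<le> u0 * i0" "c1 * e0 \<le> u1 * i0" "c0 * e1 \<le> u1 * i0"
  shows "(c1 + c0) * (e1 + e0) \<le> (u1 + u0) * (i1 + i0)"
proof -
  define a b p q where "a = c1 * e0" and "b = c0 * e1" and "p = u1 * i0" and "q = u0 * i1"
  have "(c1 * e1) * (c0 * e0) \<le> (u1 * i1) * (u0 * i0)"
    by (rule mult_mono) (use assms in \<open>auto intro: mult_nonneg_nonneg\<close>)
  then have ab: "a * b \<le> p * q"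
    by (simp add: a_def b_def p_def q_def mult_ac)
  have "0 \<le> (p - a) * (p - b)"
    using assms by (intro mult_nonneg_nonneg) (auto simp: a_def b_def p_def)
  with ab have "p * (a + b) \<le> p * (p + q)"
    by (simp add: algebra_simps)
  moreover have "0 < p"
    using nonneg by (simp add: p_def)
  ultimately have "a + b \<le> p + q"
    by simp
  then show ?thesis
    using assms by (simp add: a_def b_def p_def q_def algebra_simps)
qed

text \<open>
  Summing out one spin: the new function allows the spin at \<open>x\<close> to be either value when \<open>x\<close> is in the
  set, and keeps \<open>x\<close> absent otherwise. Supermodularity of \<open>f\<close> applies term by term unless \<open>x\<close> lies in both
  sets; that case is the two-point inequality.
\<close>

lemma log_supermodular_sum_over_point:
  assumes f: "log_supermodular f"
  shows "log_supermodular (\<lambda>C. f C + (if x \<in> C then f (C - {x}) else 0))"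
    (is "log_supermodular ?g")
proof (rule log_supermodularI)
  fix C :: "'a set" assume "finite C"
  then show "0 < ?g C"
    using log_supermodular_pos[OF f] by (simp add: add_pos_pos)
next
  fix C E :: "'a set" assume fin: "finite C" "finite E"
  note le = log_supermodularD[OF f]
  note pos = log_supermodular_pos[OF f]
  consider "x \<notin> C" "x \<notin> E" | "x \<in> C" "x \<notin> E" | "x \<notin> C" "x \<in> E" | "x \<in> C" "x \<in> E"
    by blast
  then show "?g C * ?g E \<le> ?g (C \<union> E) * ?g (C \<inter> E)"
  proof cases
    case 1
    then show ?thesis
      using le[OF fin] by simp
  next
    case 2
    have "C - {x} \<union> E = C \<union> E - {x}" "(C - {x}) \<inter> E = C \<inter> E"
      using 2 by auto
    then show ?thesis
      using le[OF fin] le[of "C - {x}" E] fin 2 by (simp add: distrib_right)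
  next
    case 3
    have "C \<union> (E - {x}) = C \<union> E - {x}" "C \<inter> (E - {x}) = C \<inter> E"
      using 3 by auto
    then show ?thesis
      using le[OF fin] le[of C "E - {x}"] fin 3 by (simp add: distrib_left distrib_right)
  next
    case 4
    have eqs: "(C - {x}) \<union> E = C \<union> E" "(C - {x}) \<inter> E = C \<inter> E - {x}"
      "C \<union> (E - {x}) = C \<union> E" "C \<inter> (E - {x}) = C \<inter> E - {x}"
      "(C - {x}) \<union> (E - {x}) = C \<union> E - {x}" "(C - {x}) \<inter> (E - {x}) = C \<inter> E - {x}"
      using 4 by auto
    have "(f C + f (C - {x})) * (f E + f (E - {x})) \<le>
        (f (C \<union> E) + f (C \<union> E - {x})) * (f (C \<inter> E) + f (C \<inter> E - {x}))"
      using le[OF fin] le[of "C - {x}" E] le[of C "E - {x}"] le[of "C - {x}" "E - {x}"] fin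
      by (intro two_point_inequality) (simp_all add: eqs pos less_imp_le)
    then show ?thesis
      using 4 by simp
  qed
qed

lemma log_supermodular_sum_over_set:
  assumes f: "log_supermodular f" and "finite F"
  shows "log_supermodular (\<lambda>C. \<Sum>S\<in>Pow (F \<inter> C). f (C - S))"
  using \<open>finite F\<close>
proof (induction F)
  case empty
  then show ?case
    using f by simp
next
  case (insert x F)
  let ?g = "\<lambda>C. \<Sum>S\<in>Pow (F \<inter> C). f (C - S)"
  have "(\<Sum>S\<in>Pow (insert x F \<inter> C). f (C - S)) = ?g C + (if x \<in> C then ?g (C - {x}) else 0)" for C
  proof (cases "x \<in> C")
    case True
    have inj: "inj_on (insert x) (Pow (F \<inter> C))"
      using insert.hyps by (auto simp: inj_on_def)
    have "(\<Sum>S\<in>Pow (insert x F \<inter> C). f (C - S)) =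
        ?g C + (\<Sum>S\<in>insert x ` Pow (F \<inter> C). f (C - S))"
      using True insert.hyps by (simp add: Int_insert_left Pow_insert) (subst sum.union_disjoint; auto)
    also have "(\<Sum>S\<in>insert x ` Pow (F \<inter> C). f (C - S)) = (\<Sum>S\<in>Pow (F \<inter> C). f (C - insert x S))"
      by (subst sum.reindex[OF inj]) simp
    also have "\<dots> = ?g (C - {x})"
      using insert.hyps by (intro sum.cong) (auto intro!: arg_cong[of _ _ f])
    finally show ?thesis
      using True by simp
  qed simp
  then show ?case
    using log_supermodular_sum_over_point[OF insert.IH, of x] by simp
qed

text \<open>
  This is the FKG inequality in the form needed below: for the Ising model with plus boundary condition
  the sum over subsets of \<open>C\<close> is the partition function of \<open>C\<close>, and quotients of partition functions are
  probabilities of events "all spins of a given set are plus". It follows by summing out the points of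
  \<open>C \<union> E\<close> one after the other; the set \<open>S\<close> in the preceding lemma is the part that is removed, whence the
  complement \<open>D - S\<close> in the reindexing.
\<close>

theorem log_supermodular_sum_Pow:
  assumes f: "log_supermodular f"
  shows "log_supermodular (\<lambda>C. \<Sum>S\<in>Pow C. f S)"
proof (rule log_supermodularI)
  fix C :: "'a set" assume "finite C"
  then show "0 < (\<Sum>S\<in>Pow C. f S)"
    by (intro sum_pos) (auto intro: log_supermodular_pos[OF f] finite_subset)
next
  fix C E :: "'a set" assume fin: "finite C" "finite E"
  have *: "(\<Sum>S\<in>Pow ((C \<union> E) \<inter> D). f (D - S)) = (\<Sum>S\<in>Pow D. f S)" if "D \<subseteq> C \<union> E" for D
    using that by (intro sum.reindex_bij_witness[of _ "\<lambda>S. D - S" "\<lambda>S. D - S"]) auto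
  have "log_supermodular (\<lambda>D. \<Sum>S\<in>Pow ((C \<union> E) \<inter> D). f (D - S))"
    using fin by (intro log_supermodular_sum_over_set[OF f]) simp
  from log_supermodularD[OF this fin]
  show "(\<Sum>S\<in>Pow C. f S) * (\<Sum>S\<in>Pow E. f S) \<le>
      (\<Sum>S\<in>Pow (C \<union> E). f S) * (\<Sum>S\<in>Pow (C \<inter> E). f S)"
    by (simp only: *[of C] *[of E] *[of "C \<union> E"] *[of "C \<inter> E"] Un_upper1 Un_upper2 order_refl inf.coboundedI1)
qed

section \<open>Plus-boundary partition functions as sums over sets of minus spins\<close>

text \<open>
  With \<open>S\<close> the set of minus spins, these are the edges between opposite spins.
\<close>

definition cut_edges :: "(int \<times> int) set \<Rightarrow> (int \<times> int) set set" where
  "cut_edges S = {e \<in> nn_edges. e \<inter> S \<noteq> {} \<and> \<not> e \<subseteq> S}"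

definition edges_at :: "(int \<times> int) set \<Rightarrow> (int \<times> int) set set" where
  "edges_at S = {e \<in> nn_edges. e \<inter> S \<noteq> {}}"

lemma nn_edgesE:
  assumes "e \<in> nn_edges"
  obtains x y where "e = {x, y}" "x \<noteq> y" "\<bar>fst x - fst y\<bar> + \<bar>snd x - snd y\<bar> = 1"
  using assms unfolding nn_edges_def by fastforce

lemma edges_at_singleton:
  "edges_at {(a, b)} \<subseteq> {{(a, b), (a + 1, b)}, {(a, b), (a - 1, b)}, {(a, b), (a, b + 1)}, {(a, b), (a, b - 1)}}"
proof
  fix e assume e: "e \<in> edges_at {(a, b)}"
  then obtain x y where xy: "e = {x, y}" "\<bar>fst x - fst y\<bar> + \<bar>snd x - snd y\<bar> = 1"
    by (auto simp: edges_at_def nn_edges_def)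
  have "(a, b) = x \<or> (a, b) = y"
    using e xy by (auto simp: edges_at_def)
  then have "\<exists>z. e = {(a, b), z} \<and> \<bar>a - fst z\<bar> + \<bar>b - snd z\<bar> = 1"
  proof
    assume "(a, b) = x"
    then show ?thesis using xy by (intro exI[of _ y]) auto
  next
    assume "(a, b) = y"
    then show ?thesis
      using xy by (intro exI[of _ x]) (auto simp: insert_commute abs_minus_commute)
  qed
  then obtain c d where cd: "e = {(a, b), (c, d)}" "\<bar>a - c\<bar> + \<bar>b - d\<bar> = 1"
    by auto
  then have "c = a + 1 \<and> d = b \<or> c = a - 1 \<and> d = b \<or> c = a \<and> d = b + 1 \<or> c = a \<and> d = b - 1"
    by arith
  then show "e \<in> {{(a, b), (a + 1, b)}, {(a, b), (a - 1, b)}, {(a, b), (a, b + 1)}, {(a, b), (a, b - 1)}}"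
    using cd by auto
qed

lemma finite_edges_at: "finite S \<Longrightarrow> finite (edges_at S)"
  and card_edges_at: "finite S \<Longrightarrow> card (edges_at S) \<le> 4 * card S"
proof -
  have 1: "finite (edges_at {x})" "card (edges_at {x}) \<le> 4" for x
  proof -
    obtain a b where x: "x = (a, b)" by (cases x)
    let ?E = "[{(a, b), (a + 1, b)}, {(a, b), (a - 1, b)}, {(a, b), (a, b + 1)}, {(a, b), (a, b - 1)}]"
    have sub: "edges_at {x} \<subseteq> set ?E"
      using edges_at_singleton[of a b] by (simp add: x)
    then show "finite (edges_at {x})"
      by (rule finite_subset) simp
    have "card (edges_at {x}) \<le> card (set ?E)"
      using sub by (intro card_mono) simp_all
    also have "\<dots> \<le> 4"
      using card_length[of ?E] by simp
    finally show "card (edges_at {x}) \<le> 4" .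
  qed
  have U: "edges_at S = (\<Union>x\<in>S. edges_at {x})" for S
    by (auto simp: edges_at_def)
  show "finite (edges_at S)" if "finite S"
    using that 1 by (subst U) blast
  show "card (edges_at S) \<le> 4 * card S" if "finite S"
  proof -
    have "card (edges_at S) \<le> (\<Sum>x\<in>S. card (edges_at {x}))"
      by (subst U) (rule card_UN_le[OF that])
    also have "\<dots> \<le> (\<Sum>x\<in>S. 4)"
      using 1 by (intro sum_mono)
    finally show ?thesis by simp
  qed
qed

lemma finite_cut_edges: "finite S \<Longrightarrow> finite (cut_edges S)"
  by (rule finite_subset[OF _ finite_edges_at]) (auto simp: cut_edges_def edges_at_def)

text \<open>
  An edge cut by \<open>S \<union> T\<close> or by \<open>S \<inter> T\<close> is cut by \<open>S\<close> or by \<open>T\<close>; an edge cut by both of the former joins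
  \<open>S \<inter> T\<close> to the complement of \<open>S \<union> T\<close>, so it is cut by both of the latter.
\<close>

lemma card_cut_edges_submodular:
  assumes "finite S" "finite T"
  shows "card (cut_edges (S \<union> T)) + card (cut_edges (S \<inter> T)) \<le> card (cut_edges S) + card (cut_edges T)"
proof -
  have 1: "cut_edges (S \<union> T) \<union> cut_edges (S \<inter> T) \<subseteq> cut_edges S \<union> cut_edges T"
    by (auto simp: cut_edges_def)
  have 2: "cut_edges (S \<union> T) \<inter> cut_edges (S \<inter> T) \<subseteq> cut_edges S \<inter> cut_edges T"
    by (auto simp: cut_edges_def)
  have fin: "finite (cut_edges S)" "finite (cut_edges T)" "finite (cut_edges (S \<union> T))" "finite (cut_edges (S \<inter> T))"
    using assms by (auto intro: finite_cut_edges)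
  have "card (cut_edges (S \<union> T)) + card (cut_edges (S \<inter> T)) =
      card (cut_edges (S \<union> T) \<union> cut_edges (S \<inter> T)) + card (cut_edges (S \<union> T) \<inter> cut_edges (S \<inter> T))"
    using fin by (intro card_Un_Int)
  also have "\<dots> \<le> card (cut_edges S \<union> cut_edges T) + card (cut_edges S \<inter> cut_edges T)"
    using fin 1 2 by (intro add_mono card_mono) auto
  also have "\<dots> = card (cut_edges S) + card (cut_edges T)"
    using fin by (intro card_Un_Int[symmetric])
  finally show ?thesis .
qed

lemma card_cut_edges_Un_le:
  assumes "finite S" "finite M"
  shows "card (cut_edges (S \<union> M)) \<le> card (cut_edges S) + 4 * card M"
    and "card (cut_edges S) \<le> card (cut_edges (S \<union> M)) + 4 * card M"
proof -
  have sub: "cut_edges (S \<union> M) \<subseteq> cut_edges S \<union> edges_at M" "cut_edges S \<subseteq> cut_edges (S \<union> M) \<union> edges_at M"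
    by (auto simp: cut_edges_def edges_at_def)
  have *: "card A \<le> card B + 4 * card M" if "A \<subseteq> B \<union> edges_at M" "finite B" for A B
  proof -
    have "card A \<le> card (B \<union> edges_at M)"
      using that assms finite_edges_at by (intro card_mono) auto
    also have "\<dots> \<le> card B + card (edges_at M)"
      by (rule card_Un_le)
    finally show ?thesis
      using card_edges_at[OF assms(2)] by simp
  qed
  show "card (cut_edges (S \<union> M)) \<le> card (cut_edges S) + 4 * card M"
    "card (cut_edges S) \<le> card (cut_edges (S \<union> M)) + 4 * card M"
    using *[OF sub(1)] *[OF sub(2)] assms finite_cut_edges by auto
qed

definition translate :: "int \<Rightarrow> int \<times> int \<Rightarrow> int \<times> int" where
  "translate t x = (fst x + t, snd x)"

lemma shift_shift [simp]: "translate s (translate t x) = translate (s + t) x" "translate 0 x = x"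
  by (simp_all add: translate_def)

lemma inj_translate: "inj (translate t)"
  by (auto simp: inj_def translate_def prod_eq_iff)

lemma translate_nn_edges: "e \<in> nn_edges \<Longrightarrow> translate t ` e \<in> nn_edges"
  unfolding nn_edges_def by (fastforce simp: translate_def)

lemma card_cut_edges_translate: "card (cut_edges (translate t ` S)) = card (cut_edges S)"
proof -
  have sub: "(`) (translate t) ` cut_edges S \<subseteq> cut_edges (translate t ` S)" for t S
    using inj_translate[of t] translate_nn_edges
    by (auto simp: cut_edges_def inj_image_subset_iff simp flip: image_Int)
  have inv: "translate (- t) ` translate t ` S = S" "translate t ` translate (- t) ` S = S" for S
    by (simp_all add: image_image)
  have "(`) (translate t) ` cut_edges S = cut_edges (translate t ` S)"
  proof (intro equalityI sub subsetI)
    fix e assume "e \<in> cut_edges (translate t ` S)"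
    then have "translate (- t) ` e \<in> cut_edges S"
      using sub[of "- t" "translate t ` S"] by (auto simp: inv)
    then show "e \<in> (`) (translate t) ` cut_edges S"
      by (rule rev_image_eqI) (simp add: inv)
  qed
  moreover have "inj_on ((`) (translate t)) (cut_edges S)"
    using inj_translate[of t] by (auto simp: inj_on_def inj_image_eq_iff)
  ultimately show ?thesis
    by (metis card_image)
qed

definition cut_weight :: "real \<Rightarrow> (int \<times> int) set \<Rightarrow> real" where
  "cut_weight \<beta> S = exp (- 2 * \<beta> * card (cut_edges S))"

text \<open>
  The normalization \<open>\<sigma>\<^sub>x \<sigma>\<^sub>y - 1\<close> makes the weight of a configuration depend on its set of minus spins
  alone and not on the volume. Fixing spins of a volume to be plus therefore just deletes their sites from
  \<open>D\<close>, and every conditional probability given plus spins becomes a quotient of such sums.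
\<close>

definition plus_partition :: "real \<Rightarrow> (int \<times> int) set \<Rightarrow> real" where
  "plus_partition \<beta> D = (\<Sum>S\<in>Pow D. cut_weight \<beta> S)"

lemma log_supermodular_cut_weight:
  assumes "0 \<le> \<beta>"
  shows "log_supermodular (cut_weight \<beta>)"
proof (rule log_supermodularI)
  fix S T :: "(int \<times> int) set" assume "finite S" "finite T"
  then have "real (card (cut_edges (S \<union> T)) + card (cut_edges (S \<inter> T))) \<le> real (card (cut_edges S) + card (cut_edges T))"
    using card_cut_edges_submodular by (intro of_nat_mono)
  then have "2 * \<beta> * real (card (cut_edges (S \<union> T)) + card (cut_edges (S \<inter> T))) \<le> 2 * \<beta> * real (card (cut_edges S) + card (cut_edges T))"
    using assms by (intro mult_left_mono) auto
  then show "cut_weight \<beta> S * cut_weight \<beta> T \<le> cut_weight \<beta> (S \<union> T) * cut_weight \<beta> (S \<inter> T)"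
    unfolding cut_weight_def exp_add[symmetric] by (simp add: algebra_simps)
qed (simp add: cut_weight_def)

lemma log_supermodular_plus_partition:
  "0 \<le> \<beta> \<Longrightarrow> log_supermodular (plus_partition \<beta>)"
  unfolding plus_partition_def[abs_def]
  by (intro log_supermodular_sum_Pow log_supermodular_cut_weight)

lemma plus_partition_pos: "finite D \<Longrightarrow> 0 < plus_partition \<beta> D"
  unfolding plus_partition_def by (intro sum_pos) (auto simp: cut_weight_def)

lemma plus_partition_translate: "plus_partition \<beta> (translate t ` D) = plus_partition \<beta> D"
proof -
  have "plus_partition \<beta> (translate t ` D) = (\<Sum>S\<in>(`) (translate t) ` Pow D. cut_weight \<beta> S)"
    by (simp add: plus_partition_def image_Pow_surj)
  also have "\<dots> = (\<Sum>S\<in>Pow D. cut_weight \<beta> (translate t ` S))"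
    using inj_translate[of t] by (subst sum.reindex) (auto simp: inj_on_def inj_image_eq_iff)
  finally show ?thesis
    by (simp add: plus_partition_def cut_weight_def card_cut_edges_translate)
qed

text \<open>
  The larger \<open>H\<close> is, the farther away are the plus spins that surround \<open>A\<close>, and the smaller is the
  probability \<open>plus_partition \<beta> H / plus_partition \<beta> (H \<union> A)\<close> that all of \<open>A\<close> is plus. Existence of the
  specification, its translation invariance and the superadditivity of the logarithm of
  \<open>line_partition\<close> all come from this lemma, for different choices of \<open>H\<close>, \<open>H'\<close> and \<open>A\<close>.
\<close>

lemma plus_partition_ratio_mono:
  assumes "0 \<le> \<beta>" "finite H'" "finite A" "H \<subseteq> H'" "H' \<inter> A = {}"
  shows "plus_partition \<beta> (H \<union> A) / plus_partition \<beta> H \<le>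
         plus_partition \<beta> (H' \<union> A) / plus_partition \<beta> H'"
proof -
  have fin: "finite H"
    using assms finite_subset by blast
  have "(H \<union> A) \<union> H' = H' \<union> A" "(H \<union> A) \<inter> H' = H"
    using assms by auto
  then have "plus_partition \<beta> (H \<union> A) * plus_partition \<beta> H' \<le>
      plus_partition \<beta> (H' \<union> A) * plus_partition \<beta> H"
    using log_supermodularD[OF log_supermodular_plus_partition[OF assms(1)], of "H \<union> A" H'] assms fin
    by simp
  then show ?thesis
    using fin assms by (simp add: frac_le_eq divide_simps plus_partition_pos)
qed

section \<open>The line in a sea of plus spins: infinite-volume weights\<close>

definition off_line :: "nat \<Rightarrow> (int \<times> int) set" where
  "off_line n = centered_square n - UNIV \<times> {0}"

text \<open>
  The unnormalized weight, in the square of side \<open>2 n + 1\<close>, of the event that the minus spins on the line are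
  exactly those of \<open>M\<close>, relative to the event that there are none. No volume on the line enters, which is why
  the normalizations of the specification cancel in the telescoping potential.
\<close>

definition line_ratio :: "real \<Rightarrow> nat \<Rightarrow> int set \<Rightarrow> real" where
  "line_ratio \<beta> n M =
     (\<Sum>S\<in>Pow (off_line n). cut_weight \<beta> (S \<union> M \<times> {0})) / plus_partition \<beta> (off_line n)"

definition line_weight :: "real \<Rightarrow> int set \<Rightarrow> real" where
  "line_weight \<beta> M = lim (\<lambda>n. line_ratio \<beta> n M)"

definition line_partition :: "real \<Rightarrow> int set \<Rightarrow> real" where
  "line_partition \<beta> V = (\<Sum>M\<in>Pow V. line_weight \<beta> M)"

lemma finite_centered_square [simp]: "finite (centered_square n)"
  by (simp add: centered_square_def)

lemma finite_off_line [simp]: "finite (off_line n)"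
  by (simp add: off_line_def)

lemma off_line_disjoint: "off_line n \<inter> V \<times> {0} = {}"
  by (auto simp: off_line_def)

lemma off_line_mono: "m \<le> n \<Longrightarrow> off_line m \<subseteq> off_line n"
  by (auto simp: off_line_def centered_square_def)

lemma sum_Pow_Un:
  assumes "A \<inter> B = {}"
  shows "(\<Sum>S\<in>Pow (A \<union> B). f S) = (\<Sum>T\<in>Pow B. \<Sum>S\<in>Pow A. f (S \<union> T))"
proof -
  have "(\<Sum>S\<in>Pow (A \<union> B). f S) = (\<Sum>(T, S)\<in>Pow B \<times> Pow A. f (S \<union> T))"
    using assms
    by (intro sum.reindex_bij_witness[of _ "\<lambda>(T, S). S \<union> T" "\<lambda>S. (S \<inter> B, S \<inter> A)"])
       (auto intro!: arg_cong[of _ _ f])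
  then show ?thesis
    by (simp add: sum.cartesian_product)
qed

lemma sum_Pow_line: "(\<Sum>T\<in>Pow (V \<times> {0::int}). f T) = (\<Sum>M\<in>Pow V. f (M \<times> {0}))"
proof -
  have "Pow (V \<times> {0::int}) = (\<lambda>M. M \<times> {0}) ` Pow V"
  proof (intro equalityI subsetI)
    fix T assume "T \<in> Pow (V \<times> {0::int})"
    then have "T = {i. (i, 0) \<in> T} \<times> {0}" "{i. (i, 0) \<in> T} \<subseteq> V"
      by auto
    then show "T \<in> (\<lambda>M. M \<times> {0}) ` Pow V"
      by blast
  qed auto
  moreover have "inj_on (\<lambda>M. M \<times> {0::int}) (Pow V)"
    by (auto simp: inj_on_def times_eq_iff)
  ultimately show ?thesis
    by (simp add: sum.reindex)
qed

lemma plus_partition_ratio_eq_sum: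
  "plus_partition \<beta> (off_line n \<union> V \<times> {0}) / plus_partition \<beta> (off_line n) =
     (\<Sum>M\<in>Pow V. line_ratio \<beta> n M)"
  unfolding plus_partition_def[of _ "off_line n \<union> V \<times> {0}"] sum_Pow_Un[OF off_line_disjoint]
    sum_Pow_line line_ratio_def sum_divide_distrib ..

lemma line_ratio_empty [simp]: "line_ratio \<beta> n {} = 1"
  using plus_partition_pos[OF finite_off_line, of \<beta> n] by (simp add: line_ratio_def plus_partition_def)

text \<open>
  Finite energy: flipping the spins of \<open>M\<close> affects at most four edges per site.
\<close>

lemma cut_weight_Un_bounds:
  assumes "0 \<le> \<beta>" "finite S" "finite M"
  shows "cut_weight \<beta> (S \<union> M) \<le> exp (8 * \<beta> * card M) * cut_weight \<beta> S"
    and "exp (- 8 * \<beta> * card M) * cut_weight \<beta> S \<le> cut_weight \<beta> (S \<union> M)"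
proof -
  have "real (card (cut_edges (S \<union> M))) \<le> real (card (cut_edges S) + 4 * card M)"
    "real (card (cut_edges S)) \<le> real (card (cut_edges (S \<union> M)) + 4 * card M)"
    using card_cut_edges_Un_le[OF assms(2,3)] by (auto intro!: of_nat_mono simp del: of_nat_add)
  from this[THEN mult_left_mono, of "2 * \<beta>"] assms(1)
  show "cut_weight \<beta> (S \<union> M) \<le> exp (8 * \<beta> * card M) * cut_weight \<beta> S"
    "exp (- 8 * \<beta> * card M) * cut_weight \<beta> S \<le> cut_weight \<beta> (S \<union> M)"
    by (simp_all add: cut_weight_def algebra_simps flip: exp_add)
qed

lemma line_ratio_bounds:
  assumes "0 \<le> \<beta>" "finite M"
  shows "line_ratio \<beta> n M \<le> exp (8 * \<beta> * card M)"
    and "exp (- 8 * \<beta> * card M) \<le> line_ratio \<beta> n M"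
proof -
  note fin = finite_subset[OF _ finite_off_line]
  have c: "card (M \<times> {0::int}) = card M"
    by (simp add: card_cartesian_product)
  have "(\<Sum>S\<in>Pow (off_line n). cut_weight \<beta> (S \<union> M \<times> {0})) \<le>
      exp (8 * \<beta> * card M) * plus_partition \<beta> (off_line n)"
    unfolding plus_partition_def sum_distrib_left
    using cut_weight_Un_bounds(1)[of \<beta> _ "M \<times> {0}"] assms fin by (intro sum_mono) (auto simp: c)
  then show "line_ratio \<beta> n M \<le> exp (8 * \<beta> * card M)"
    using plus_partition_pos[OF finite_off_line] by (simp add: line_ratio_def divide_le_eq)
  have "exp (- 8 * \<beta> * card M) * plus_partition \<beta> (off_line n) \<le>
      (\<Sum>S\<in>Pow (off_line n). cut_weight \<beta> (S \<union> M \<times> {0}))"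
    unfolding plus_partition_def sum_distrib_left
    using cut_weight_Un_bounds(2)[of \<beta> _ "M \<times> {0}"] assms fin by (intro sum_mono) (auto simp: c)
  then show "exp (- 8 * \<beta> * card M) \<le> line_ratio \<beta> n M"
    using plus_partition_pos[OF finite_off_line] by (simp add: line_ratio_def le_divide_eq)
qed

text \<open>
  The sum is a quotient of partition functions. It increases with \<open>n\<close>: the spins on the line outside \<open>V\<close> stay
  plus, and the surrounding plus spins off the line recede.
\<close>

lemma convergent_sum_line_ratio:
  assumes "0 \<le> \<beta>" "finite V"
  shows "convergent (\<lambda>n. \<Sum>M\<in>Pow V. line_ratio \<beta> n M)"
proof (intro Bseq_mono_convergent allI impI)
  show "Bseq (\<lambda>n. \<Sum>M\<in>Pow V. line_ratio \<beta> n M)"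
  proof (rule BseqI')
    fix n
    have 1: "\<bar>line_ratio \<beta> n M\<bar> \<le> exp (8 * \<beta> * card M)" if "M \<in> Pow V" for M
    proof -
      have "finite M"
        using that assms(2) finite_subset by auto
      from line_ratio_bounds[OF assms(1) this, of n] show ?thesis
        using exp_gt_zero[of "- 8 * \<beta> * card M"] by linarith
    qed
    have "norm (\<Sum>M\<in>Pow V. line_ratio \<beta> n M) \<le> (\<Sum>M\<in>Pow V. norm (line_ratio \<beta> n M))"
      by (rule norm_sum)
    also have "\<dots> \<le> (\<Sum>M\<in>Pow V. exp (8 * \<beta> * card M))"
      using 1 by (intro sum_mono) simp
    finally show "norm (\<Sum>M\<in>Pow V. line_ratio \<beta> n M) \<le> (\<Sum>M\<in>Pow V. exp (8 * \<beta> * card M))" .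
  qed
next
  fix m n :: nat assume "m \<le> n"
  then show "(\<Sum>M\<in>Pow V. line_ratio \<beta> m M) \<le> (\<Sum>M\<in>Pow V. line_ratio \<beta> n M)"
    unfolding plus_partition_ratio_eq_sum[symmetric]
    using assms by (intro plus_partition_ratio_mono off_line_mono off_line_disjoint) auto
qed

text \<open>
  A single configuration on \<open>M\<close> is not a monotone event, but induction over \<open>M\<close> isolates its weight from
  the convergent sum over all subsets of \<open>M\<close>.
\<close>

lemma line_ratio_tendsto:
  assumes "0 \<le> \<beta>" "finite M"
  shows "(\<lambda>n. line_ratio \<beta> n M) \<longlonglongrightarrow> line_weight \<beta> M"
proof -
  have "convergent (\<lambda>n. line_ratio \<beta> n M)"
    using assms(2)
  proof (induction M rule: finite_psubset_induct)
    case (psubset M)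
    have "line_ratio \<beta> n M = (\<Sum>B\<in>Pow M. line_ratio \<beta> n B) - (\<Sum>B\<in>Pow M - {M}. line_ratio \<beta> n B)" for n
      using psubset.hyps by (simp add: sum_diff1)
    moreover have "convergent (\<lambda>n. \<Sum>B\<in>Pow M - {M}. line_ratio \<beta> n B)"
      by (rule convergent_sum) (use psubset.IH in auto)
    ultimately show ?case
      using convergent_diff[OF convergent_sum_line_ratio[OF assms(1) psubset.hyps]] by simp
  qed
  then show ?thesis
    by (simp add: line_weight_def convergent_LIMSEQ_iff)
qed

lemma line_partition_limit:
  assumes "0 \<le> \<beta>" "finite V"
  shows "(\<lambda>n. plus_partition \<beta> (off_line n \<union> V \<times> {0}) / plus_partition \<beta> (off_line n))
    \<longlonglongrightarrow> line_partition \<beta> V"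
  unfolding plus_partition_ratio_eq_sum line_partition_def
  using assms by (intro tendsto_sum line_ratio_tendsto) (auto intro: finite_subset)

lemma line_weight_bounds:
  assumes "0 \<le> \<beta>" "finite M"
  shows "line_weight \<beta> M \<le> exp (8 * \<beta> * card M)" "0 < line_weight \<beta> M"
proof -
  show "line_weight \<beta> M \<le> exp (8 * \<beta> * card M)"
    using line_ratio_bounds(1)[OF assms] by (intro LIMSEQ_le_const2[OF line_ratio_tendsto[OF assms]]) auto
  have "0 < exp (- 8 * \<beta> * card M)"
    by simp
  also have "\<dots> \<le> line_weight \<beta> M"
    using line_ratio_bounds(2)[OF assms] by (intro LIMSEQ_le_const[OF line_ratio_tendsto[OF assms]]) auto
  finally show "0 < line_weight \<beta> M" .
qed

lemma line_weight_empty [simp]: "line_weight \<beta> {} = 1"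
  by (simp add: line_weight_def)

lemma line_partition_ge_1:
  assumes "0 \<le> \<beta>" "finite V"
  shows "1 \<le> line_partition \<beta> V"
proof -
  have "line_weight \<beta> {} \<le> line_partition \<beta> V"
    unfolding line_partition_def
    using assms line_weight_bounds(2)[OF assms(1)]
    by (intro member_le_sum) (auto intro: finite_subset less_imp_le)
  then show ?thesis
    by simp
qed

lemma line_partition_le:
  assumes "0 \<le> \<beta>" "finite V"
  shows "line_partition \<beta> V \<le> (2 * exp (8 * \<beta>)) ^ card V"
proof -
  have "line_weight \<beta> M \<le> exp (8 * \<beta>) ^ card V" if "M \<subseteq> V" for M
  proof -
    have "line_weight \<beta> M \<le> exp (8 * \<beta> * card M)"
      using line_weight_bounds(1) assms that finite_subset by blast
    also have "\<dots> \<le> exp (8 * \<beta> * card V)"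
      using assms that by (simp add: mult_left_mono card_mono)
    finally show ?thesis
      by (simp add: exp_of_nat2_mult)
  qed
  then have "line_partition \<beta> V \<le> (\<Sum>M\<in>Pow V. exp (8 * \<beta>) ^ card V)"
    unfolding line_partition_def by (intro sum_mono) simp
  then show ?thesis
    using assms by (simp add: card_Pow power_mult_distrib)
qed

text \<open>
  Setting the spins of \<open>I\<close> free, instead of plus, makes plus on \<open>J\<close> less likely.
\<close>

lemma line_partition_supermultiplicative:
  assumes "0 \<le> \<beta>" "finite I" "finite J" "I \<inter> J = {}"
  shows "line_partition \<beta> I * line_partition \<beta> J \<le> line_partition \<beta> (I \<union> J)"
proof (rule LIMSEQ_le)
  let ?r = "\<lambda>V n. plus_partition \<beta> (off_line n \<union> V \<times> {0}) / plus_partition \<beta> (off_line n)"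
  show "(\<lambda>n. ?r I n * ?r J n) \<longlonglongrightarrow> line_partition \<beta> I * line_partition \<beta> J"
    using assms by (intro tendsto_mult line_partition_limit)
  show "?r (I \<union> J) \<longlonglongrightarrow> line_partition \<beta> (I \<union> J)"
    using assms by (intro line_partition_limit) auto
  have "?r I n * ?r J n \<le> ?r (I \<union> J) n" for n
  proof -
    let ?Z = "\<lambda>V. plus_partition \<beta> (off_line n \<union> V \<times> {0})"
    have pos: "0 < ?Z I" "0 < plus_partition \<beta> (off_line n)"
      using assms by (auto intro!: plus_partition_pos)
    have "off_line n \<union> I \<times> {0} \<union> J \<times> {0} = off_line n \<union> (I \<union> J) \<times> {0}"
      by auto
    moreover have "(off_line n \<union> I \<times> {0}) \<inter> J \<times> {0} = {}"
      using assms(4) off_line_disjoint[of n J] by auto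
    ultimately have "?r J n \<le> ?Z (I \<union> J) / ?Z I"
      using plus_partition_ratio_mono[OF assms(1), of "off_line n \<union> I \<times> {0}" "J \<times> {0}" "off_line n"] assms
      by simp
    then have "?r I n * ?r J n \<le> ?r I n * (?Z (I \<union> J) / ?Z I)"
      using pos by (intro mult_left_mono) auto
    then show ?thesis
      using pos by simp
  qed
  then show "\<exists>N. \<forall>n\<ge>N. ?r I n * ?r J n \<le> ?r (I \<union> J) n"
    by blast
qed

text \<open>
  The centered squares are not translation invariant, but a translate of one is contained in a slightly
  larger one. Monotonicity then gives one inequality for every translation, and applying it to the inverse
  translation gives the other.
\<close>

lemma line_partition_translate:
  assumes "0 \<le> \<beta>" "finite V"
  shows "line_partition \<beta> ((\<lambda>i. i + t) ` V) = line_partition \<beta> V"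
proof -
  let ?r = "\<lambda>V n. plus_partition \<beta> (off_line n \<union> V \<times> {0}) / plus_partition \<beta> (off_line n)"
  have le: "line_partition \<beta> ((\<lambda>i. i + t) ` V) \<le> line_partition \<beta> V" if "finite V" for t V
  proof (rule LIMSEQ_le)
    let ?k = "nat \<bar>t\<bar>" and ?V = "(\<lambda>i. i + t) ` V"
    show "?r ?V \<longlonglongrightarrow> line_partition \<beta> ?V"
      using assms that by (intro line_partition_limit) auto
    show "(\<lambda>n. ?r V (n + ?k)) \<longlonglongrightarrow> line_partition \<beta> V"
      using line_partition_limit[OF assms(1) that] by (rule LIMSEQ_ignore_initial_segment)
    have "?r ?V n \<le> ?r V (n + ?k)" for n
    proof -
      let ?H = "translate (- t) ` off_line n"
      have "translate (- t) ` (?V \<times> {0}) = V \<times> {0}"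
        by (force simp: translate_def)
      then have eq: "?r ?V n = plus_partition \<beta> (?H \<union> V \<times> {0}) / plus_partition \<beta> ?H"
        unfolding image_Un[symmetric]
        using plus_partition_translate[of \<beta> "- t"] by (metis image_Un)
      have "?H \<subseteq> off_line (n + ?k)"
        by (auto simp: off_line_def centered_square_def translate_def)
      then show ?thesis
        unfolding eq using assms(1) that off_line_disjoint
        by (intro plus_partition_ratio_mono) auto
    qed
    then show "\<exists>N. \<forall>n\<ge>N. ?r ?V n \<le> ?r V (n + ?k)"
      by blast
  qed
  have "(\<lambda>i. i + - t) ` (\<lambda>i. i + t) ` V = V"
    by (simp add: image_image)
  then show ?thesis
    using le[OF assms(2), of t] le[of "(\<lambda>i. i + t) ` V" "- t"] assms(2) by simp
qed

section \<open>The specification with plus boundary condition in terms of the weights\<close>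

definition spin_of :: "'a set \<Rightarrow> 'a set \<Rightarrow> 'a \<Rightarrow> real" where
  "spin_of V N = (\<lambda>i\<in>V. if i \<in> N then - 1 else 1)"

lemma spin_configs_eq_image: "spin_configs V = spin_of V ` Pow V"
proof (intro equalityI subsetI)
  fix \<sigma> :: "'a \<Rightarrow> real" assume s: "\<sigma> \<in> spin_configs V"
  then have "\<sigma> i = (if i \<in> {i \<in> V. \<sigma> i = - 1} then - 1 else 1)" if "i \<in> V" for i
    using that by (auto simp: spin_configs_def)
  then have "\<sigma> = spin_of V {i \<in> V. \<sigma> i = - 1}"
    using s by (auto simp: spin_of_def spin_configs_def fun_eq_iff PiE_iff extensional_def)
  then show "\<sigma> \<in> spin_of V ` Pow V"
    by blast
qed (auto simp: spin_of_def spin_configs_def)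

lemma inj_on_spin_of: "inj_on (spin_of V) (Pow V)"
proof (rule inj_onI)
  fix M N assume "M \<in> Pow V" "N \<in> Pow V" and eq: "spin_of V M = spin_of V N"
  moreover have "i \<in> M \<longleftrightarrow> i \<in> N" if "i \<in> V" for i
    using fun_cong[OF eq, of i] that by (simp add: spin_of_def split: if_splits)
  ultimately show "M = N"
    by auto
qed

lemma sum_spin_configs: "(\<Sum>\<sigma>\<in>spin_configs V. f \<sigma>) = (\<Sum>N\<in>Pow V. f (spin_of V N))"
  by (simp add: spin_configs_eq_image sum.reindex[OF inj_on_spin_of])

text \<open>
  For an edge the factor \<open>\<sigma>\<^sub>x \<sigma>\<^sub>y - 1\<close> is \<open>- 2\<close> if the edge is cut and \<open>0\<close> otherwise; a cut edge has an end in
  \<open>S \<subseteq> \<Lambda>\<close>, so it is among the edges that the energy counts.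
\<close>

lemma ising_weight_spin_of:
  assumes "finite \<Lambda>" "S \<subseteq> \<Lambda>"
  shows "ising_weight \<beta> \<Lambda> (spin_of \<Lambda> S) = cut_weight \<beta> S"
proof -
  have s: "plus_ext \<Lambda> (spin_of \<Lambda> S) x = (if x \<in> S then - 1 else 1)" for x
    using assms(2) by (auto simp: plus_ext_def spin_of_def)
  have *: "(\<Prod>x\<in>e. plus_ext \<Lambda> (spin_of \<Lambda> S) x) - 1 = (if e \<in> cut_edges S then - 2 else 0)"
    if e: "e \<in> nn_edges" for e
  proof -
    obtain x y where "e = {x, y}" "x \<noteq> y"
      using nn_edgesE[OF e] by metis
    then show ?thesis
      using e by (auto simp: s cut_edges_def)
  qed
  have fin: "finite {e \<in> nn_edges. e \<inter> \<Lambda> \<noteq> {}}"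
    using finite_edges_at[OF assms(1)] by (simp add: edges_at_def)
  have "(\<Sum>e\<in>{e \<in> nn_edges. e \<inter> \<Lambda> \<noteq> {}}. (\<Prod>x\<in>e. plus_ext \<Lambda> (spin_of \<Lambda> S) x) - 1) =
      (\<Sum>e\<in>{e \<in> nn_edges. e \<inter> \<Lambda> \<noteq> {}}. if e \<in> cut_edges S then - 2 else 0)"
    using * by (intro sum.cong) auto
  also have "\<dots> = (\<Sum>e\<in>{e \<in> nn_edges. e \<inter> \<Lambda> \<noteq> {}} \<inter> cut_edges S. - 2)"
    by (rule sum.inter_restrict[OF fin, symmetric])
  also have "{e \<in> nn_edges. e \<inter> \<Lambda> \<noteq> {}} \<inter> cut_edges S = cut_edges S"
    using assms(2) by (auto simp: cut_edges_def)
  finally show ?thesis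
    by (simp add: ising_weight_def cut_weight_def)
qed

lemma prob_ising_plus:
  assumes "finite \<Lambda>"
  shows "\<P>(X in ising_plus \<beta> \<Lambda>. P X) =
    (\<Sum>S\<in>{S \<in> Pow \<Lambda>. P (spin_of \<Lambda> S)}. cut_weight \<beta> S) / plus_partition \<beta> \<Lambda>"
proof -
  let ?A = "{\<sigma> \<in> spin_configs \<Lambda>. P \<sigma>}"
  have fin: "finite (spin_configs \<Lambda> :: ('a \<Rightarrow> real) set)" if "finite \<Lambda>" for \<Lambda> :: "'a set"
    using that by (simp add: spin_configs_def finite_PiE)
  have Z: "(\<Sum>\<tau>\<in>spin_configs \<Lambda>. ising_weight \<beta> \<Lambda> \<tau>) = plus_partition \<beta> \<Lambda>"
    unfolding sum_spin_configs plus_partition_def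
    using assms by (intro sum.cong) (auto simp: ising_weight_spin_of)
  have nonneg: "0 \<le> ising_weight \<beta> \<Lambda> \<sigma> / plus_partition \<beta> \<Lambda>" for \<sigma>
    using plus_partition_pos[OF assms, of \<beta>] by (simp add: ising_weight_def)
  have "\<P>(X in ising_plus \<beta> \<Lambda>. P X) = (\<Sum>\<sigma>\<in>?A. ising_weight \<beta> \<Lambda> \<sigma> / plus_partition \<beta> \<Lambda>)"
    unfolding ising_plus_def space_point_measure Z measure_def
    using fin[OF assms] nonneg sum_nonneg[of ?A, OF nonneg]
    by (subst emeasure_point_measure_finite2) auto
  also have "?A = spin_of \<Lambda> ` {S \<in> Pow \<Lambda>. P (spin_of \<Lambda> S)}"
    by (auto simp: spin_configs_eq_image)
  also have "(\<Sum>\<sigma>\<in>\<dots>. ising_weight \<beta> \<Lambda> \<sigma> / plus_partition \<beta> \<Lambda>) =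
      (\<Sum>S\<in>{S \<in> Pow \<Lambda>. P (spin_of \<Lambda> S)}. ising_weight \<beta> \<Lambda> (spin_of \<Lambda> S) / plus_partition \<beta> \<Lambda>)"
    by (subst sum.reindex[OF inj_on_subset[OF inj_on_spin_of]]) auto
  also have "\<dots> = (\<Sum>S\<in>{S \<in> Pow \<Lambda>. P (spin_of \<Lambda> S)}. cut_weight \<beta> S) / plus_partition \<beta> \<Lambda>"
    using assms by (simp add: ising_weight_spin_of sum_divide_distrib)
  finally show ?thesis .
qed

lemma line_cond_prob:
  assumes V: "V \<subseteq> {- int n..int n}" and \<sigma>: "\<And>i. i \<in> V \<Longrightarrow> \<sigma> i \<in> {- 1, 1}"
  shows "\<P>(X in ising_plus \<beta> (centered_square n). (\<forall>i\<in>V. X (i, 0) = \<sigma> i)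
        \<bar> (\<forall>i\<in>{- int n..int n} - V. X (i, 0) = all_plus i)) =
    line_ratio \<beta> n {i \<in> V. \<sigma> i = - 1} /
      (plus_partition \<beta> (off_line n \<union> V \<times> {0}) / plus_partition \<beta> (off_line n))"
proof -
  let ?L = "centered_square n" and ?M = "{i \<in> V. \<sigma> i = - 1}"
  let ?s = "\<lambda>S i. spin_of ?L S (i, 0)"
  have s: "?s S i = (if (i, 0) \<in> S then - 1 else 1)" if "i \<in> {- int n..int n}" for S i
    using that by (simp add: spin_of_def centered_square_def)
  have sV: "?s S i = \<sigma> i \<longleftrightarrow> ((i, 0) \<in> S \<longleftrightarrow> i \<in> ?M)" if "i \<in> V" for S i
    using s[of i S] \<sigma>[OF that] V that by (auto split: if_splits)
  have sW: "?s S i = all_plus i \<longleftrightarrow> (i, 0) \<notin> S" if "i \<in> {- int n..int n}" for S i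
    using s[OF that, of S] by (simp add: all_plus_def)
  have L: "(i, 0) \<in> ?L \<longleftrightarrow> i \<in> {- int n..int n}" for i
    by (simp add: centered_square_def)
  have off: "x \<in> off_line n \<longleftrightarrow> x \<in> ?L \<and> snd x \<noteq> 0" for x
    by (cases x) (simp add: off_line_def)
  have "{S \<in> Pow ?L. \<forall>i\<in>{- int n..int n} - V. ?s S i = all_plus i} = Pow (off_line n \<union> V \<times> {0})" (is "?C = ?D")
  proof (intro equalityI subsetI)
    fix S assume S: "S \<in> ?C"
    have "x \<in> off_line n \<union> V \<times> {0}" if x: "x \<in> S" for x
    proof (cases "snd x = 0")
      case True
      then obtain i where i: "x = (i, 0)"
        by (cases x) auto
      then have "i \<in> {- int n..int n}"
        using S x L by auto
      then show ?thesis
        using S x sW i by auto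
    qed (use S x off in auto)
    then show "S \<in> ?D"
      by blast
  next
    fix S assume "S \<in> ?D"
    moreover have "off_line n \<subseteq> ?L" "V \<times> {0} \<subseteq> ?L"
      using V L by (auto simp: off)
    ultimately have "S \<subseteq> ?L" "\<forall>i\<in>{- int n..int n} - V. (i, 0) \<notin> S"
      by (auto simp: off)
    then show "S \<in> ?C"
      using sW by auto
  qed
  then have den: "\<P>(X in ising_plus \<beta> ?L. \<forall>i\<in>{- int n..int n} - V. X (i, 0) = all_plus i) =
      plus_partition \<beta> (off_line n \<union> V \<times> {0}) / plus_partition \<beta> ?L"
    by (simp add: prob_ising_plus plus_partition_def)
  have "{S \<in> Pow ?L. (\<forall>i\<in>V. ?s S i = \<sigma> i) \<and> (\<forall>i\<in>{- int n..int n} - V. ?s S i = all_plus i)} =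
      (\<lambda>T. T \<union> ?M \<times> {0}) ` Pow (off_line n)" (is "?A = ?B")
  proof (intro equalityI subsetI)
    fix S assume S: "S \<in> ?A"
    have "x \<in> off_line n \<union> ?M \<times> {0}" if x: "x \<in> S" for x
    proof (cases "snd x = 0")
      case True
      then obtain i where i: "x = (i, 0)"
        by (cases x) auto
      then have "i \<in> {- int n..int n}"
        using S x L by auto
      then have "i \<in> V"
        using S x sW i by auto
      then show ?thesis
        using S x sV i by auto
    qed (use S x off in auto)
    moreover have "?M \<times> {0} \<subseteq> S"
      using S sV by auto
    ultimately have "S = (S \<inter> off_line n) \<union> ?M \<times> {0}"
      by blast
    then show "S \<in> ?B"
      by blast
  next
    fix S assume "S \<in> ?B"
    then show "S \<in> ?A"
      using V by (auto simp: sV sW off subset_iff L)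
  qed
  moreover have "inj_on (\<lambda>T. T \<union> ?M \<times> {0}) (Pow (off_line n))"
    using off_line_disjoint[of n ?M] by (intro inj_onI) blast
  ultimately have num: "\<P>(X in ising_plus \<beta> ?L. (\<forall>i\<in>V. X (i, 0) = \<sigma> i) \<and>
        (\<forall>i\<in>{- int n..int n} - V. X (i, 0) = all_plus i)) =
      line_ratio \<beta> n ?M * plus_partition \<beta> (off_line n) / plus_partition \<beta> ?L"
    using plus_partition_pos[OF finite_off_line, of \<beta> n]
    by (simp add: prob_ising_plus sum.reindex line_ratio_def)
  show ?thesis
    unfolding cond_prob_def num den
    using plus_partition_pos[OF finite_centered_square, of \<beta> n] by simp
qed

lemma eventually_van_hove:
  "eventually (\<lambda>V. finite V \<and> F \<subseteq> V) van_hove" if "finite F"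
  using that unfolding van_hove_def
  by (intro filter_leD[OF inf_le1]) (auto simp: eventually_finite_subsets_at_top)

lemma line_spec_plus:
  assumes "0 \<le> \<beta>" "finite V" "\<And>i. i \<in> V \<Longrightarrow> \<sigma> i \<in> {- 1, 1}"
  shows "line_spec \<beta> V \<sigma> all_plus = line_weight \<beta> {i \<in> V. \<sigma> i = - 1} / line_partition \<beta> V"
  unfolding line_spec_def
proof (rule limI, rule Lim_transform_eventually)
  let ?r = "\<lambda>n. plus_partition \<beta> (off_line n \<union> V \<times> {0}) / plus_partition \<beta> (off_line n)"
  show "(\<lambda>n. line_ratio \<beta> n {i \<in> V. \<sigma> i = - 1} / ?r n)
      \<longlonglongrightarrow> line_weight \<beta> {i \<in> V. \<sigma> i = - 1} / line_partition \<beta> V"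
    using assms line_partition_ge_1[OF assms(1,2)]
    by (intro tendsto_divide line_ratio_tendsto line_partition_limit) auto
  have "\<forall>\<^sub>F n in sequentially. V \<subseteq> {- int n..int n}"
    using eventually_compose_filterlim[OF eventually_van_hove[OF assms(2)] filterlim_intervals_van_hove]
    by simp
  then show "\<forall>\<^sub>F n in sequentially. line_ratio \<beta> n {i \<in> V. \<sigma> i = - 1} / ?r n =
      \<P>(X in ising_plus \<beta> (centered_square n). (\<forall>i\<in>V. X (i, 0) = \<sigma> i)
        \<bar> (\<forall>i\<in>{- int n..int n} - V. X (i, 0) = all_plus i))"
    by eventually_elim (use line_cond_prob assms(3) in simp)
qed


section \<open>Telescoping and factorization of the free partition function\<close>

lemma sum_int_telescope:
  fixes G :: "int \<Rightarrow> real"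
  shows "(\<Sum>j\<in>{a..a + int k}. G (j + 1) - G j) = G (a + int k + 1) - G a"
proof (induction k)
  case (Suc k)
  have "{a..a + int (Suc k)} = insert (a + int k + 1) {a..a + int k}"
    by auto
  then show ?case
    using Suc by (simp add: add_ac)
qed simp

text \<open>
  The interaction of \<open>[j, i]\<close> is minus a second difference of \<open>h\<close> in the two end points. Summing over \<open>j\<close> with
  the right end point \<open>i\<close> fixed leaves \<open>h [a, i - 1] - h [a, i]\<close>, and summing over \<open>i\<close> leaves \<open>- h [a, b]\<close>.
  Singletons are the case \<open>j = i\<close>, where three of the four intervals are empty.
\<close>

lemma sum_telescoping_interactions:
  fixes h U :: "int set \<Rightarrow> real"
  assumes interval: "\<And>i j. j \<le> i \<Longrightarrow> {j..i} \<subseteq> {a..b} \<Longrightarrow>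
      U {j..i} = h {j<..i} + h {j..<i} - h {j<..<i} - h {j..i}"
    and other: "\<And>A. (\<And>i j :: int. j \<le> i \<Longrightarrow> A \<noteq> {j..i}) \<Longrightarrow> U A = 0"
    and h: "h {} = 0"
  shows "(\<Sum>A\<in>Pow {a..b}. U A) = - h {a..b}"
proof -
  have "int k \<le> b - a + 1 \<Longrightarrow> (\<Sum>A\<in>Pow {a..a + int k - 1}. U A) = - h {a..a + int k - 1}" for k
  proof (induction k)
    case 0
    have "U {} = 0"
      by (intro other) auto
    then show ?case
      using h by simp
  next
    case (Suc k)
    let ?c = "a + int k"
    let ?E = "(\<lambda>j. {j..?c}) ` {a..?c}"
    \<comment> \<open>Adding the right end point \<open>?c\<close> adds only the intervals that end there.\<close>
    define G where "G j = h {j..?c} - h {j..?c - 1}" for j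
    have U: "U {j..?c} = G (j + 1) - G j" if "j \<in> {a..?c}" for j
    proof -
      have "{j<..?c} = {j + 1..?c}" "{j..<?c} = {j..?c - 1}" "{j<..<?c} = {j + 1..?c - 1}"
        by auto
      moreover have "{j..?c} \<subseteq> {a..b}"
        using that Suc.prems by auto
      ultimately show ?thesis
        using interval[of j ?c] that by (simp add: G_def)
    qed
    have inj: "inj_on (\<lambda>j. {j..?c}) {a..?c}"
      by (auto simp: inj_on_def)
    have "(\<Sum>A\<in>Pow {a..?c}. U A) = (\<Sum>A\<in>Pow {a..?c - 1} \<union> ?E. U A)"
    proof (rule sum.mono_neutral_right)
      show "\<forall>A\<in>Pow {a..?c} - (Pow {a..?c - 1} \<union> ?E). U A = 0"
      proof
        fix A assume A: "A \<in> Pow {a..?c} - (Pow {a..?c - 1} \<union> ?E)"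
        show "U A = 0"
        proof (rule other)
          fix i j :: int assume "j \<le> i"
          show "A \<noteq> {j..i}"
          proof
            assume [simp]: "A = {j..i}"
            have "a \<le> j" "i \<le> ?c"
              using A \<open>j \<le> i\<close> by auto
            moreover have "i \<noteq> ?c"
              using A \<open>j \<le> i\<close> by auto
            ultimately have "A \<in> Pow {a..?c - 1}"
              by auto
            then show False
              using A by blast
          qed
        qed
      qed
    qed auto
    also have "\<dots> = (\<Sum>A\<in>Pow {a..?c - 1}. U A) + (\<Sum>A\<in>?E. U A)"
      by (rule sum.union_disjoint) auto
    also have "(\<Sum>A\<in>?E. U A) = (\<Sum>j\<in>{a..?c}. G (j + 1) - G j)"
      by (simp add: sum.reindex[OF inj] U)
    also have "\<dots> = - G a"
      unfolding sum_int_telescope by (simp add: G_def h)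
    finally show ?case
      using Suc by (simp add: G_def)
  qed
  from this[of "nat (b - a + 1)"] show ?thesis
  proof (cases "a \<le> b")
    case False
    have "U {} = 0"
      by (intro other) auto
    then show ?thesis
      using False h by simp
  qed simp
qed

lemma line_spec_plus_ext:
  assumes "0 \<le> \<beta>" "finite A" "B \<subseteq> A" "A \<subseteq> V" "N \<subseteq> V"
  shows "line_spec \<beta> A (plus_ext B (spin_of V N)) all_plus =
    line_weight \<beta> (N \<inter> B) / line_partition \<beta> A"
proof -
  have "{i \<in> A. plus_ext B (spin_of V N) i = - 1} = N \<inter> B"
    using assms by (auto simp: plus_ext_def spin_of_def split: if_splits)
  then show ?thesis
    using assms by (subst line_spec_plus) (auto simp: plus_ext_def spin_of_def)
qed

lemma telescoping_potential_interval:
  assumes \<beta>: "0 \<le> \<beta>" and "j \<le> i" and V: "{j..i} \<subseteq> V" and N: "N \<subseteq> V"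
  defines "h \<equiv> \<lambda>B. ln (line_weight \<beta> (N \<inter> B))"
  shows "telescoping_potential \<beta> {j..i} (spin_of V N) =
    h {j<..i} + h {j..<i} - h {j<..<i} - h {j..i}"
proof -
  let ?R = "line_partition \<beta> {j..i}"
  have R: "0 < ?R"
    using line_partition_ge_1[OF \<beta>, of "{j..i}"] by simp
  have pos: "0 < line_weight \<beta> (N \<inter> B)" if "B \<subseteq> {j..i}" for B
    by (intro line_weight_bounds(2)[OF \<beta>] finite_subset[OF _ finite_atLeastAtMost_int[of j i]])
       (use that in auto)
  show ?thesis
  proof (cases "j = i")
    case True
    have "line_spec \<beta> {i} all_plus all_plus = 1 / line_partition \<beta> {i}"
      using line_spec_plus[OF \<beta>, of "{i}" all_plus] by (auto simp: all_plus_def)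
    moreover have "line_spec \<beta> {i} (plus_ext {i} (spin_of V N)) all_plus =
        line_weight \<beta> (N \<inter> {i}) / line_partition \<beta> {i}"
      using V N True by (intro line_spec_plus_ext[OF \<beta>]) auto
    ultimately show ?thesis
      using True R pos[of "{i}"]
      by (simp add: telescoping_potential_def h_def ln_div)
  next
    case False
    then have "j < i"
      using assms by simp
    have \<gamma>: "line_spec \<beta> {j..i} (plus_ext B (spin_of V N)) all_plus = line_weight \<beta> (N \<inter> B) / ?R"
      if "B \<subseteq> {j..i}" for B
      using V N that by (intro line_spec_plus_ext[OF \<beta>]) auto
    have mm: "Min {j..i} = j" "Max {j..i} = i"
      using \<open>j < i\<close> by (auto intro: Min_eqI Max_eqI)
    have "\<nexists>k. {j..i} = {k}"
      using \<open>j < i\<close> by auto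
    then have "telescoping_potential \<beta> {j..i} (spin_of V N) =
        ln ((line_weight \<beta> (N \<inter> {j<..i}) / ?R * (line_weight \<beta> (N \<inter> {j..<i}) / ?R)) /
            (line_weight \<beta> (N \<inter> {j<..<i}) / ?R * (line_weight \<beta> (N \<inter> {j..i}) / ?R)))"
      using \<open>j < i\<close> unfolding telescoping_potential_def mm Let_def
      by (subst (1 2 3 4) \<gamma>) auto
    also have "\<dots> = h {j<..i} + h {j..<i} - h {j<..<i} - h {j..i}"
    proof -
      have "0 < line_weight \<beta> (N \<inter> {j<..i})" "0 < line_weight \<beta> (N \<inter> {j..<i})"
        "0 < line_weight \<beta> (N \<inter> {j<..<i})" "0 < line_weight \<beta> (N \<inter> {j..i})"
        by (intro pos; auto)+
      then show ?thesis
        using R by (simp add: h_def ln_mult ln_div)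
    qed
    finally show ?thesis .
  qed
qed

lemma telescoping_potential_eq_0:
  assumes "\<And>i j. j \<le> i \<Longrightarrow> A \<noteq> {j..i}"
  shows "telescoping_potential \<beta> A \<xi> = 0"
proof -
  have "\<not> (\<exists>i. A = {i})"
    using assms[of i i for i] by auto
  moreover have "\<not> (\<exists>j i. j < i \<and> A = {j..i})"
    using assms less_imp_le by blast
  ultimately show ?thesis
    unfolding telescoping_potential_def by (simp only: if_False)
qed

lemma telescoping_potential_cong:
  assumes "\<And>i. i \<in> A \<Longrightarrow> \<xi> i = \<eta> i"
  shows "telescoping_potential \<beta> A \<xi> = telescoping_potential \<beta> A \<eta>"
proof (cases "\<exists>i j. j \<le> i \<and> A = {j..i}")
  case True
  then obtain i j where "j \<le> i" and A: "A = {j..i}"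
    by blast
  have mm: "Min {j..i} = j" "Max {j..i} = i"
    using \<open>j \<le> i\<close> by (auto intro: Min_eqI Max_eqI)
  have "plus_ext B \<xi> = plus_ext B \<eta>" if "B \<subseteq> {j..i}" for B
    using that assms unfolding A by (auto simp: plus_ext_def fun_eq_iff)
  then have "plus_ext {j..i} \<xi> = plus_ext {j..i} \<eta>" "plus_ext {j<..i} \<xi> = plus_ext {j<..i} \<eta>"
    "plus_ext {j..<i} \<xi> = plus_ext {j..<i} \<eta>" "plus_ext {j<..<i} \<xi> = plus_ext {j<..<i} \<eta>"
    by (auto simp: subset_iff)
  then show ?thesis
    unfolding telescoping_potential_def A mm Let_def by (simp only:)
next
  case False
  then show ?thesis
    using telescoping_potential_eq_0[of A] by metis
qed

text \<open>
  By telescoping, the Gibbs factor of a configuration on an interval is the weight that the specification gives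
  to it, relative to that of all plus; the sum over configurations is the inverse of the probability of all plus.
\<close>

lemma free_partition_interval:
  assumes "0 \<le> \<beta>"
  shows "free_partition (telescoping_potential \<beta>) {a..b} = line_partition \<beta> {a..b}"
  unfolding free_partition_def sum_spin_configs line_partition_def
proof (rule sum.cong[OF refl])
  fix N assume N: "N \<in> Pow {a..b}"
  have "(\<Sum>A\<in>Pow {a..b}. telescoping_potential \<beta> A (spin_of {a..b} N)) =
      - ln (line_weight \<beta> (N \<inter> {a..b}))"
    using N assms
    by (intro sum_telescoping_interactions telescoping_potential_interval telescoping_potential_eq_0) auto
  moreover have "N \<inter> {a..b} = N"
    using N by auto
  moreover have "0 < line_weight \<beta> N"
    using N assms by (intro line_weight_bounds) (auto intro: finite_subset)
  ultimately show "exp (- (\<Sum>A\<in>Pow {a..b}. telescoping_potential \<beta> A (spin_of {a..b} N))) =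
      line_weight \<beta> N"
    by simp
qed

text \<open>
  The telescoping potential lives on intervals, and no interval contained in \<open>V \<union> W\<close> meets both parts when
  there is a gap between them.
\<close>

lemma free_partition_separated:
  fixes \<beta> :: real
  assumes fin: "finite V" "finite W" and sep: "\<And>x y. x \<in> V \<Longrightarrow> y \<in> W \<Longrightarrow> x + 1 < y"
  defines "U \<equiv> telescoping_potential \<beta>"
  shows "free_partition U (V \<union> W) = free_partition U V * free_partition U W"
proof -
  define E where "E X N = (\<Sum>A\<in>Pow X. U A (spin_of X N))" for X N
  have disj: "V \<inter> W = {}"
    using sep by fastforce
  have E: "E (V \<union> W) (S \<union> T) = E V S + E W T" if "S \<subseteq> V" "T \<subseteq> W" for S T
  proof -
    have "E (V \<union> W) (S \<union> T) = (\<Sum>A\<in>Pow V \<union> Pow W. U A (spin_of (V \<union> W) (S \<union> T)))"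
      unfolding E_def
    proof (rule sum.mono_neutral_right)
      show "\<forall>A\<in>Pow (V \<union> W) - (Pow V \<union> Pow W). U A (spin_of (V \<union> W) (S \<union> T)) = 0"
      proof
        fix A assume A: "A \<in> Pow (V \<union> W) - (Pow V \<union> Pow W)"
        then obtain x y where x: "x \<in> A" "x \<in> V" and y: "y \<in> A" "y \<in> W"
          by auto
        show "U A (spin_of (V \<union> W) (S \<union> T)) = 0"
          unfolding U_def
        proof (rule telescoping_potential_eq_0, rule notI)
          fix i j assume Aij: "A = {j..i}"
          \<comment> \<open>The right neighbour of the last site of \<open>V\<close> in the interval would have to be in \<open>W\<close>.\<close>
          let ?m = "Max (V \<inter> A)"
          have m: "?m \<in> V \<inter> A"
            using x fin by (intro Max_in) auto
          then have "?m + 1 < y"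
            using sep y by auto
          then have "?m + 1 \<in> A"
            using m y Aij by auto
          moreover have "?m + 1 \<notin> V \<inter> A"
            using Max_ge[of "V \<inter> A" "?m + 1"] fin by auto
          ultimately have "?m + 1 \<in> W"
            using A by auto
          then show False
            using sep[of ?m "?m + 1"] m by auto
        qed
      qed
    qed (use fin in auto)
    also have "\<dots> = (\<Sum>A\<in>Pow V. U A (spin_of (V \<union> W) (S \<union> T))) +
        (\<Sum>A\<in>Pow W. U A (spin_of (V \<union> W) (S \<union> T))) -
        (\<Sum>A\<in>Pow V \<inter> Pow W. U A (spin_of (V \<union> W) (S \<union> T)))"
      using fin by (intro sum_Un) auto
    also have "Pow V \<inter> Pow W = {{}}"
      using disj by auto
    also have "(\<Sum>A\<in>{{}}. U A (spin_of (V \<union> W) (S \<union> T))) = 0"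
      using telescoping_potential_eq_0[of "{}"] by (simp add: U_def)
    also have "(\<Sum>A\<in>Pow V. U A (spin_of (V \<union> W) (S \<union> T))) = E V S"
      unfolding E_def U_def using that disj
      by (intro sum.cong telescoping_potential_cong) (auto simp: spin_of_def)
    also have "(\<Sum>A\<in>Pow W. U A (spin_of (V \<union> W) (S \<union> T))) = E W T"
      unfolding E_def U_def using that disj
      by (intro sum.cong telescoping_potential_cong) (auto simp: spin_of_def)
    finally show ?thesis
      by simp
  qed
  have Z: "free_partition U X = (\<Sum>N\<in>Pow X. exp (- E X N))" for X
    by (simp add: free_partition_def sum_spin_configs E_def)
  have "free_partition U (V \<union> W) = (\<Sum>T\<in>Pow W. \<Sum>S\<in>Pow V. exp (- E V S) * exp (- E W T))"
    unfolding Z sum_Pow_Un[OF disj] by (intro sum.cong refl) (simp add: E flip: exp_add)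
  also have "\<dots> = free_partition U V * free_partition U W"
    unfolding Z by (simp add: sum_product sum.swap[of _ "Pow W"])
  finally show ?thesis .
qed

lemma free_partition_pos:
  assumes "finite V"
  shows "0 < free_partition U V"
  unfolding free_partition_def sum_spin_configs using assms by (intro sum_pos) auto

section \<open>The pressure\<close>

text \<open>
  Fekete's lemma, with the error terms that are needed to add the estimate over many intervals: the upper bound is
  exact since \<open>L\<close> is the supremum of \<open>a n / n\<close>, and the lower bound loses a constant, independent of \<open>n\<close>,
  besides the error in the slope.
\<close>

lemma superadditive_linear_bounds:
  fixes a :: "nat \<Rightarrow> real"
  assumes super: "\<And>m n. a m + a n \<le> a (m + n)" and nonneg: "\<And>n. 0 \<le> a n"
    and le: "\<And>n. a n \<le> C * real n"
  obtains L where "\<And>n. a n \<le> L * real n"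
    and "\<And>\<epsilon>. 0 < \<epsilon> \<Longrightarrow> \<exists>K\<ge>0. \<forall>n. (L - \<epsilon>) * real n - K \<le> a n"
proof -
  define L where "L = (SUP n\<in>{1..}. a n / real n)"
  have bdd: "bdd_above ((\<lambda>n. a n / real n) ` {1..})"
    using le by (intro bdd_aboveI[of _ C]) (auto simp: divide_le_eq)
  have less_L: "y < L \<longleftrightarrow> (\<exists>m\<in>{1..}. y < a m / real m)" for y
    unfolding L_def by (rule less_cSUP_iff[OF _ bdd]) simp
  have upper: "a n \<le> L * real n" for n
  proof (cases "n = 0")
    case True
    then show ?thesis
      using le[of 0] by simp
  next
    case False
    then have "a n / real n \<le> L"
      unfolding L_def using bdd by (intro cSUP_upper) auto
    then show ?thesis
      using False by (simp add: divide_le_eq)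
  qed
  have mult: "real q * a m \<le> a (q * m + r)" for q m r
  proof (induction q)
    case (Suc q)
    then show ?case
      using super[of m "q * m + r"] by (simp add: algebra_simps)
  qed (simp add: nonneg)
  have lower: "\<exists>K\<ge>0. \<forall>n. (L - \<epsilon>) * real n - K \<le> a n" if \<epsilon>: "0 < \<epsilon>" for \<epsilon>
  proof -
    obtain m where m: "m \<ge> 1" "L - \<epsilon> < a m / real m"
      using less_L[of "L - \<epsilon>"] \<epsilon> by auto
    then have am: "(L - \<epsilon>) * real m \<le> a m"
      by (simp add: less_divide_eq)
    have "(L - \<epsilon>) * real n - \<bar>L - \<epsilon>\<bar> * real m \<le> a n" for n
    proof -
      let ?q = "n div m" and ?r = "n mod m"
      have n: "real n = real ?q * real m + real ?r"
        by (simp flip: of_nat_mult of_nat_add)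
      have "(L - \<epsilon>) * real ?r \<le> \<bar>L - \<epsilon>\<bar> * real m"
        using m by (intro mult_mono) (auto simp: less_imp_le)
      moreover have "(L - \<epsilon>) * real n = real ?q * ((L - \<epsilon>) * real m) + (L - \<epsilon>) * real ?r"
        unfolding n by (simp add: algebra_simps)
      moreover have "real ?q * ((L - \<epsilon>) * real m) \<le> real ?q * a m"
        using am by (intro mult_left_mono) auto
      moreover have "real ?q * a m \<le> a n"
        using mult[of ?q m ?r] by simp
      ultimately show ?thesis
        by linarith
    qed
    then show ?thesis
      by (intro exI[of _ "\<bar>L - \<epsilon>\<bar> * real m"]) auto
  qed
  show ?thesis
    using upper lower by (rule that)
qed

lemma line_partition_interval:
  assumes "0 \<le> \<beta>" "a \<le> b + 1"
  shows "line_partition \<beta> {a..b} = line_partition \<beta> {1..int (card {a..b})}"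
proof -
  have "{a..b} = (\<lambda>i. i + (a - 1)) ` {1..int (card {a..b})}"
    using assms(2) by auto
  then have "line_partition \<beta> {a..b} = line_partition \<beta> ((\<lambda>i. i + (a - 1)) ` {1..int (card {a..b})})"
    by (rule arg_cong)
  also have "\<dots> = line_partition \<beta> {1..int (card {a..b})}"
    by (intro line_partition_translate assms(1)) simp
  finally show ?thesis .
qed

lemma line_pressure_bounds:
  assumes "0 \<le> \<beta>"
  obtains L where "\<And>a b. a \<le> b \<Longrightarrow> ln (line_partition \<beta> {a..b}) \<le> L * real (card {a..b})"
    and "\<And>\<epsilon>. 0 < \<epsilon> \<Longrightarrow> \<exists>K\<ge>0. \<forall>a b. a \<le> b \<longrightarrow>
      (L - \<epsilon>) * real (card {a..b}) - K \<le> ln (line_partition \<beta> {a..b})"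
proof -
  define f where "f n = ln (line_partition \<beta> {1..int n})" for n
  have pos: "0 < line_partition \<beta> {a..b}" for a b
    using line_partition_ge_1[OF assms, of "{a..b}"] by simp
  have super: "f m + f n \<le> f (m + n)" for m n
  proof -
    have "{1..int m} \<union> {int m + 1..int m + int n} = {1..int (m + n)}"
      by auto
    then have "line_partition \<beta> {1..int m} * line_partition \<beta> {int m + 1..int m + int n} \<le>
        line_partition \<beta> {1..int (m + n)}"
      using line_partition_supermultiplicative[OF assms, of "{1..int m}" "{int m + 1..int m + int n}"]
      by auto
    then have "line_partition \<beta> {1..int m} * line_partition \<beta> {1..int n} \<le>
        line_partition \<beta> {1..int (m + n)}"
      using line_partition_interval[OF assms, of "int m + 1" "int m + int n"] by simp
    then have "ln (line_partition \<beta> {1..int m} * line_partition \<beta> {1..int n}) \<le> f (m + n)"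
      unfolding f_def using pos by (intro ln_mono mult_pos_pos)
    then show ?thesis
      using pos[THEN less_imp_neq, THEN not_sym] by (simp add: f_def ln_mult)
  qed
  have nonneg: "0 \<le> f n" for n
    using line_partition_ge_1[OF assms] by (simp add: f_def)
  have le: "f n \<le> ln (2 * exp (8 * \<beta>)) * real n" for n
  proof -
    have "f n \<le> ln ((2 * exp (8 * \<beta>)) ^ n)"
      unfolding f_def using pos line_partition_le[OF assms, of "{1..int n}"] by (intro ln_mono) auto
    also have "\<dots> = real n * ln (2 * exp (8 * \<beta>))"
      by (rule ln_realpow)
    finally show ?thesis
      by (simp add: mult.commute)
  qed
  obtain L where upper: "\<And>n. f n \<le> L * real n"
    and lower: "\<And>\<epsilon>. 0 < \<epsilon> \<Longrightarrow> \<exists>K\<ge>0. \<forall>n. (L - \<epsilon>) * real n - K \<le> f n"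
    using superadditive_linear_bounds[of f, OF super nonneg le] by blast
  have f: "ln (line_partition \<beta> {a..b}) = f (card {a..b})" if "a \<le> b" for a b
    unfolding f_def using that by (subst line_partition_interval[OF assms]) auto
  show ?thesis
  proof
    show "ln (line_partition \<beta> {a..b}) \<le> L * real (card {a..b})" if "a \<le> b" for a b
      unfolding f[OF that] by (rule upper)
    show "\<exists>K\<ge>0. \<forall>a b. a \<le> b \<longrightarrow>
      (L - \<epsilon>) * real (card {a..b}) - K \<le> ln (line_partition \<beta> {a..b})" if \<epsilon>: "0 < \<epsilon>" for \<epsilon>
    proof -
      obtain K where "0 \<le> K" "\<And>n. (L - \<epsilon>) * real n - K \<le> f n"
        using lower[OF \<epsilon>] by blast
      then show ?thesis
        using f by (intro exI[of _ K]) presburger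
    qed
  qed
qed

text \<open>
  The rightmost connected component; the gap in front of it is what lets its free partition function split off.
\<close>

lemma remove_last_run:
  fixes V :: "int set"
  assumes "finite V" "V \<noteq> {}"
  obtains W a b where "V = W \<union> {a..b}" "a \<le> b" "\<forall>x\<in>W. x + 1 < a"
proof -
  define b where "b = Max V"
  define a where "a = Min {a. a \<le> b \<and> {a..b} \<subseteq> V}"
  let ?A = "{a. a \<le> b \<and> {a..b} \<subseteq> V}"
  have b: "b \<in> V" "\<And>x. x \<in> V \<Longrightarrow> x \<le> b"
    using assms by (auto simp: b_def)
  have fin: "finite ?A"
    by (rule finite_subset[OF _ assms(1)]) auto
  have "b \<in> ?A"
    using b by auto
  then have a: "a \<in> ?A"
    unfolding a_def using fin by (intro Min_in) auto
  have a_le: "a \<le> c" if "c \<in> ?A" for c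
    unfolding a_def using fin that by (intro Min_le)
  show thesis
  proof
    show "V = V \<inter> {..<a} \<union> {a..b}"
      using a b by force
    show "a \<le> b"
      using a by simp
    show "\<forall>x\<in>V \<inter> {..<a}. x + 1 < a"
    proof (intro ballI, rule ccontr)
      fix x assume x: "x \<in> V \<inter> {..<a}"
      assume "\<not> x + 1 < a"
      with x have "x = a - 1"
        by auto
      then have "{x..b} = insert x {a..b}"
        using a by auto
      then have "x \<in> ?A"
        using a x by auto
      then show False
        using a_le[of x] x by auto
    qed
  qed
qed

text \<open>
  Every connected component of a volume has its own right end point in the inner boundary, so the size of the
  boundary bounds the number of components.
\<close>

lemma card_inner_boundary_Un_run:
  assumes "finite W" "a \<le> b" "\<And>x. x \<in> W \<Longrightarrow> x + 1 < a"
  shows "card (inner_boundary W) + 1 \<le> card (inner_boundary (W \<union> {a..b}))"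
proof -
  have fin: "finite (inner_boundary X)" if "finite X" for X
    using that by (simp add: inner_boundary_def)
  have "b \<notin> W" "b + 1 \<notin> W"
    using assms(2) assms(3)[of b] assms(3)[of "b + 1"] by auto
  have "i \<in> inner_boundary (W \<union> {a..b})" if i: "i \<in> inner_boundary W" for i
  proof -
    obtain j where j: "i \<in> W" "j \<notin> W" "\<bar>i - j\<bar> = 1"
      using i by (auto simp: inner_boundary_def)
    have "j \<notin> {a..b}"
      using assms(3)[OF j(1)] j(3) by auto
    then show ?thesis
      using j by (auto simp: inner_boundary_def)
  qed
  moreover have "b \<in> inner_boundary (W \<union> {a..b})"
    using assms(2) \<open>b + 1 \<notin> W\<close> unfolding inner_boundary_def
    by (auto intro!: exI[of _ "b + 1"])
  ultimately have "insert b (inner_boundary W) \<subseteq> inner_boundary (W \<union> {a..b})"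
    by blast
  then have "card (insert b (inner_boundary W)) \<le> card (inner_boundary (W \<union> {a..b}))"
    using assms(1) by (intro card_mono fin) auto
  moreover have "b \<notin> inner_boundary W"
    using \<open>b \<notin> W\<close> by (simp add: inner_boundary_def)
  ultimately show ?thesis
    using fin[OF assms(1)] by simp
qed

text \<open>
  The bounds for intervals add up over the connected components of \<open>V\<close>; the constant \<open>K\<close> is paid once per
  component, hence at most once per boundary site.
\<close>

lemma ln_free_partition_bounds:
  assumes \<beta>: "0 \<le> \<beta>" and "finite V" and "0 \<le> K"
    and upper: "\<And>a b. a \<le> b \<Longrightarrow> ln (line_partition \<beta> {a..b}) \<le> L * real (card {a..b})"
    and lower: "\<And>a b. a \<le> b \<Longrightarrow> M * real (card {a..b}) - K \<le> ln (line_partition \<beta> {a..b})"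
  shows "ln (free_partition (telescoping_potential \<beta>) V) \<le> L * real (card V)"
    and "M * real (card V) - K * real (card (inner_boundary V)) \<le>
      ln (free_partition (telescoping_potential \<beta>) V)"
proof -
  let ?Z = "free_partition (telescoping_potential \<beta>)"
  have "ln (?Z V) \<le> L * real (card V) \<and>
      M * real (card V) - K * real (card (inner_boundary V)) \<le> ln (?Z V)"
    using \<open>finite V\<close>
  proof (induction V rule: finite_psubset_induct)
    case (psubset V)
    show ?case
    proof (cases "V = {}")
      case True
      have "?Z {} = 1"
        using free_partition_interval[OF \<beta>, of 1 0] by (simp add: line_partition_def)
      then show ?thesis
        using True \<open>0 \<le> K\<close> by (simp add: inner_boundary_def)
    next
      case False
      obtain W a b where V: "V = W \<union> {a..b}" and "a \<le> b" and "\<forall>x\<in>W. x + 1 < a"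
        using remove_last_run[OF psubset.hyps False] by metis
      then have sep: "x + 1 < a" if "x \<in> W" for x
        using that by blast
      have W: "finite W"
        using psubset.hyps V by simp
      have disj: "W \<inter> {a..b} = {}"
        by (auto dest!: sep)
      have "a \<in> V" "a \<notin> W"
        using V \<open>a \<le> b\<close> disj by auto
      then have "W \<subset> V"
        using V by blast
      then have IH: "ln (?Z W) \<le> L * real (card W)"
        "M * real (card W) - K * real (card (inner_boundary W)) \<le> ln (?Z W)"
        using psubset.IH by auto
      have "?Z V = ?Z W * line_partition \<beta> {a..b}"
        unfolding V free_partition_interval[OF \<beta>, symmetric]
        using W by (intro free_partition_separated) (auto dest!: sep)
      then have ln_Z: "ln (?Z V) = ln (?Z W) + ln (line_partition \<beta> {a..b})"
        using free_partition_pos[OF W, of "telescoping_potential \<beta>"] line_partition_ge_1[OF \<beta>, of "{a..b}"] by (simp add: ln_mult)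
      have card_V: "real (card V) = real (card W) + real (card {a..b})"
        unfolding V using W disj by (simp add: card_Un_disjoint)
      have "real (card (inner_boundary W)) + 1 \<le> real (card (inner_boundary V))"
        using card_inner_boundary_Un_run[OF W \<open>a \<le> b\<close> sep] unfolding V by linarith
      then have "K * real (card (inner_boundary W)) + K \<le> K * real (card (inner_boundary V))"
        using mult_left_mono[OF _ \<open>0 \<le> K\<close>, of "real (card (inner_boundary W)) + 1"]
        by (simp add: distrib_left)
      then show ?thesis
        using IH upper[OF \<open>a \<le> b\<close>] lower[OF \<open>a \<le> b\<close>] unfolding ln_Z card_V distrib_left
        by linarith
    qed
  qed
  then show "ln (?Z V) \<le> L * real (card V)"
    and "M * real (card V) - K * real (card (inner_boundary V)) \<le> ln (?Z V)"
    by auto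
qed

lemma eventually_van_hove_boundary_small:
  assumes "0 < \<delta>"
  shows "\<forall>\<^sub>F V in van_hove. real (card (inner_boundary V)) / real (card V) < \<delta>"
proof -
  have "\<forall>\<^sub>F x in nhds 0. x < \<delta>"
    using assms eventually_nhds_in_open[of "{..<\<delta>}" 0] by auto
  then show ?thesis
    unfolding van_hove_def by (intro filter_leD[OF inf_le2] eventually_filtercomapI)
qed

theorem proposition6p3:
  fixes \<beta> :: real
  assumes "\<beta> \<ge> 0"
  shows "((\<lambda>V. ln (free_partition (telescoping_potential \<beta>) V) / real (card V))
           \<longlongrightarrow> pressure (telescoping_potential \<beta>)) van_hove"
proof -
  let ?p = "\<lambda>V. ln (free_partition (telescoping_potential \<beta>) V) / real (card V)"
  obtain L where upper: "\<And>a b. a \<le> b \<Longrightarrow> ln (line_partition \<beta> {a..b}) \<le> L * real (card {a..b})"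
    and lower: "\<And>\<epsilon>. 0 < \<epsilon> \<Longrightarrow> \<exists>K\<ge>0. \<forall>a b. a \<le> b \<longrightarrow>
      (L - \<epsilon>) * real (card {a..b}) - K \<le> ln (line_partition \<beta> {a..b})"
    using line_pressure_bounds[OF assms] by blast
  have "(?p \<longlongrightarrow> L) van_hove"
  proof (rule tendstoI)
    fix e :: real assume "0 < e"
    then obtain K where "0 \<le> K"
      and K: "\<And>a b. a \<le> b \<Longrightarrow> (L - e / 2) * real (card {a..b}) - K \<le> ln (line_partition \<beta> {a..b})"
      using lower[of "e / 2"] by auto
    let ?q = "\<lambda>V. real (card (inner_boundary V)) / real (card V)"
    \<comment> \<open>The summand \<open>1\<close> keeps the denominator positive when \<open>K = 0\<close>.\<close>
    have "\<forall>\<^sub>F V in van_hove. ?q V < e / (2 * (K + 1))"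
      using \<open>0 < e\<close> \<open>0 \<le> K\<close> by (intro eventually_van_hove_boundary_small) simp
    moreover have "\<forall>\<^sub>F V in van_hove. finite V \<and> {0} \<subseteq> V"
      by (rule eventually_van_hove) simp
    ultimately show "\<forall>\<^sub>F V in van_hove. dist (?p V) L < e"
    proof eventually_elim
      case (elim V)
      then have card: "0 < real (card V)"
        by (auto simp: card_gt_0_iff)
      note bounds = ln_free_partition_bounds[OF assms conjunct1[OF elim(2)] \<open>0 \<le> K\<close> upper K]
      have "?p V \<le> L"
        using bounds(1) card by (simp add: divide_le_eq)
      moreover have "L - e / 2 - K * ?q V \<le> ?p V"
        using bounds(2) card by (simp add: le_divide_eq left_diff_distrib)
      moreover have "K * ?q V < e / 2"
      proof -
        have "K * ?q V \<le> (K + 1) * ?q V"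
          by (intro mult_right_mono) auto
        also have "\<dots> = ?q V * (2 * (K + 1)) / 2"
          using card by (simp add: field_simps)
        also have "\<dots> < e / 2"
          using elim(1) \<open>0 \<le> K\<close> by (subst (asm) pos_less_divide_eq) auto
        finally show ?thesis .
      qed
      ultimately show ?case
        using \<open>0 < e\<close> unfolding dist_real_def by linarith
    qed
  qed
  moreover from this have "pressure (telescoping_potential \<beta>) = L"
    unfolding pressure_def by (intro tendsto_Lim van_hove_neq_bot)
  ultimately show ?thesis
    by simp
qed

end
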